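(* For every hereditary graph class $\mathcal G$, if there exists a function $f\colon\mathbb N\to\mathbb N$ such that $\mathrm{td}(G)\le f(\omega(G))$ for every graph $G\in \mathcal G$, then there exists a polynomial function $p$ such that $\mathrm{td}(G)\le p(\omega(G))$ for every graph $G\in \mathcal G$.
   Context: All graphs are finite, simple, and undirected. $\mathbb N$ is the set of all nonnegative integers. A graph class is hereditary if it is closed under vertex deletion. $\omega(G)$ is the clique number of $G$ (the maximum size of a clique). A rooted tree is a tree with a distinguished vertex called the root; a rooted forest is a disjoint union of rooted trees. The transitive closure of a rooted forest $F$ is the graph with vertex set $V(F)$ in which two vertices are adjacent if and only if one is an ancestor of the other in $F$. A treedepth decomposition of a graph $G$ is a rooted forest $F$ on the vertex set $V(G)$ such that $G$ is a subgraph of the transitive closure of $F$. The depth of a rooted forest is the maximum number of vertices on any root-to-leaf path in it. The treedepth $\mathrm{td}(G)$ is the minimum depth over all treedepth decompositions of $G$. *)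

theory Defs
  imports "Graph_Theory.Graph_Theory" "HOL-Computational_Algebra.Polynomial"
begin

text \<open>
  Finite simple undirected graphs are the digraphs satisfying \<open>pair_graph\<close>: finite,
  loopless, without parallel arcs and symmetric, an edge \<open>uv\<close> being the pair of arcs
  \<open>(u,v)\<close> and \<open>(v,u)\<close>.  The null graph is allowed.

  A class of graphs is a set of graphs over an arbitrary vertex type.  It is not required to be
  closed under isomorphism; isomorphism-closed classes are a special case.
\<close>

definition del_vertex :: "'a pair_pre_digraph \<Rightarrow> 'a \<Rightarrow> 'a pair_pre_digraph" where
  "del_vertex G v = \<lparr> pverts = pverts G - {v}, parcs = {e \<in> parcs G. fst e \<noteq> v \<and> snd e \<noteq> v} \<rparr>"

lemma with_proj_del_vertex: "with_proj (del_vertex G v) = pre_digraph.del_vert (with_proj G) v"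
  by (simp add: with_proj_def del_vertex_def pre_digraph.del_vert_def)

definition graph_class :: "'a pair_pre_digraph set \<Rightarrow> bool" where
  "graph_class \<G> \<longleftrightarrow> (\<forall>G\<in>\<G>. pair_graph G)"

definition hereditary :: "'a pair_pre_digraph set \<Rightarrow> bool" where
  "hereditary \<G> \<longleftrightarrow> (\<forall>G\<in>\<G>. \<forall>v\<in>pverts G. del_vertex G v \<in> \<G>)"

definition clique :: "'a pair_pre_digraph \<Rightarrow> 'a set \<Rightarrow> bool" where
  "clique G C \<longleftrightarrow> C \<subseteq> pverts G \<and> (\<forall>u\<in>C. \<forall>v\<in>C. u \<noteq> v \<longrightarrow> (u, v) \<in> parcs G)"

definition clique_number :: "'a pair_pre_digraph \<Rightarrow> nat" where
  "clique_number G = Max {card C | C. clique G C}"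

text \<open>
  The predicate \<open>forest\<close> of the library excludes directed cycles, so a symmetric digraph
  satisfying it has no arcs (\<open>u, v, u\<close> is a directed cycle).  Cycles of undirected graphs have
  at least three vertices.
\<close>

definition acyclic_graph :: "'a pair_pre_digraph \<Rightarrow> bool" where
  "acyclic_graph F \<longleftrightarrow>
     \<not> (\<exists>p. vpath p (with_proj F) \<and> length p \<ge> 3 \<and> (last p, hd p) \<in> parcs F)"

text \<open>
  A rooted forest is given by an undirected forest \<open>F\<close> together with the set \<open>R\<close> of the roots,
  one in each connected component.
\<close>

definition rooted_forest :: "'a pair_pre_digraph \<Rightarrow> 'a set \<Rightarrow> bool" where
  "rooted_forest F R \<longleftrightarrow> pair_graph F \<and> acyclic_graph F \<and> R \<subseteq> pverts F \<and>
     (\<forall>v\<in>pverts F. \<exists>!r. r \<in> R \<and> r \<rightarrow>\<^sup>*\<^bsub>with_proj F\<^esub> v)"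

definition root_path :: "'a pair_pre_digraph \<Rightarrow> 'a set \<Rightarrow> 'a list \<Rightarrow> 'a \<Rightarrow> bool" where
  "root_path F R p v \<longleftrightarrow> vpath p (with_proj F) \<and> hd p \<in> R \<and> last p = v"

text \<open>Every vertex is an ancestor of itself here.\<close>

definition ancestor :: "'a pair_pre_digraph \<Rightarrow> 'a set \<Rightarrow> 'a \<Rightarrow> 'a \<Rightarrow> bool" where
  "ancestor F R u v \<longleftrightarrow> (\<exists>p. root_path F R p v \<and> u \<in> set p)"

definition transitive_closure :: "'a pair_pre_digraph \<Rightarrow> 'a set \<Rightarrow> 'a pair_pre_digraph" where
  "transitive_closure F R =
     \<lparr> pverts = pverts F, parcs = {(u, v). u \<noteq> v \<and> (ancestor F R u v \<or> ancestor F R v u)} \<rparr>"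

text \<open>A leaf is a vertex without children; in particular an isolated root is a leaf.\<close>

definition leaf :: "'a pair_pre_digraph \<Rightarrow> 'a set \<Rightarrow> 'a \<Rightarrow> bool" where
  "leaf F R v \<longleftrightarrow> v \<in> pverts F \<and> (\<forall>w. ancestor F R v w \<longrightarrow> w = v)"

text \<open>The forest without vertices has depth \<open>0\<close>.\<close>

definition depth :: "'a pair_pre_digraph \<Rightarrow> 'a set \<Rightarrow> nat" where
  "depth F R = Max (insert 0 {length p | p v. root_path F R p v \<and> leaf F R v})"

definition treedepth_decomposition ::
    "'a pair_pre_digraph \<Rightarrow> 'a pair_pre_digraph \<Rightarrow> 'a set \<Rightarrow> bool" where
  "treedepth_decomposition G F R \<longleftrightarrow> rooted_forest F R \<and> pverts F = pverts G \<and>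
     subgraph (with_proj G) (with_proj (transitive_closure F R))"

definition treedepth :: "'a pair_pre_digraph \<Rightarrow> nat" where
  "treedepth G = (LEAST d. \<exists>F R. treedepth_decomposition G F R \<and> depth F R = d)"

end

theory Submission
  imports Defs
begin

text \<open>
  Long paths and large balanced bicliques have clique number at most 2 and large treedepth, so some
  induced path on \<open>k\<close> vertices and some induced biclique with parts of size \<open>s\<close> are missing from
  the class.  As \<open>k\<close> and \<open>s\<close> are constants, it suffices to bound the treedepth of a graph without
  these two by a polynomial in its clique number \<open>w\<close>.  Every set of vertices has a balanced separator
  of size polynomial in \<open>w\<close>, which yields a vertex order in which few vertices are strongly reachable
  from each vertex.  A shortest path is induced and thus has fewer than \<open>k\<close> vertices, so every weakly
  reachable vertex is reached by at most \<open>k\<close> successive strong steps.  Weak reachability is the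
  ancestor relation of a treedepth decomposition, whose depth is therefore polynomial in \<open>w\<close>.
\<close>

section \<open>Connected sets and induced paths\<close>

text \<open>The degree of the polynomial may depend on f but not on w. Only the values of f at 0, 1
  and 2 matter: they fix k and s, and w enters through the Ramsey bound \<open>(w + 1) ^ s\<close>
  and its powers, whose exponents are built from k and s. The obstacle is that a balanced separator
  first appears as the closed neighbourhood of a short induced path, and no function of w bounds its
  size. Many disjoint paths of this kind repair this: together they have few vertices, and if no
  small set separated, a single short path would meet too many of their neighbourhoods. The missing
  biclique ensures that few vertices see a large share of the paths. Balanced separators alone
  amount to a bound on treewidth, and long paths show that this says nothing about treedepth. Hence
  the missing induced path is used a second time, to limit the number of strong steps behind a weak
  one.\<close>

definition conn :: "'a rel \<Rightarrow> 'a set \<Rightarrow> bool" where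
  "conn E X \<longleftrightarrow> (\<forall>x\<in>X. \<forall>y\<in>X. (x, y) \<in> (Restr E X)\<^sup>*)"

text \<open>For \<open>x\<close> outside \<open>X\<close> this is \<open>{x}\<close> and not a
  subset of \<open>X\<close>; hence the premise \<open>x \<in> X\<close> in several lemmas
  below.\<close>

definition component :: "'a rel \<Rightarrow> 'a set \<Rightarrow> 'a \<Rightarrow> 'a set" where
  "component E X x = (Restr E X)\<^sup>* `` {x}"

text \<open>Here \<open>n\<close> counts vertices, and \<open>f\<close> matters only below
  \<open>n\<close>. No vertex set is mentioned, and \<open>n = 0\<close> always qualifies, so
  excluding all induced paths on \<open>k\<close> vertices forces \<open>k > 0\<close>.\<close>

definition induced_path :: "'a rel \<Rightarrow> (nat \<Rightarrow> 'a) \<Rightarrow> nat \<Rightarrow> bool" where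
  "induced_path E f n \<longleftrightarrow> inj_on f {..<n} \<and>
     (\<forall>i<n. \<forall>j<n. (f i, f j) \<in> E \<longleftrightarrow> i = Suc j \<or> j = Suc i)"

definition indep :: "'a rel \<Rightarrow> 'a set \<Rightarrow> bool" where
  "indep E S \<longleftrightarrow> (\<forall>u\<in>S. \<forall>v\<in>S. (u, v) \<notin> E)"

definition clique_set :: "'a rel \<Rightarrow> 'a set \<Rightarrow> bool" where
  "clique_set E S \<longleftrightarrow> (\<forall>u\<in>S. \<forall>v\<in>S. u \<noteq> v \<longrightarrow> (u, v) \<in> E)"

definition induced_biclique :: "'a rel \<Rightarrow> 'a set \<Rightarrow> 'a set \<Rightarrow> bool" where
  "induced_biclique E S T \<longleftrightarrow> S \<inter> T = {} \<and> indep E S \<and> indep E T \<and> S \<times> T \<subseteq> E"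

section \<open>Connected sets and components\<close>

lemma conn_comp:
  assumes "sym E" shows "conn E (component E X x)"
proof -
  let ?C = "component E X x"
  have *: "(x, y) \<in> (Restr E ?C)\<^sup>*" if "(x, y) \<in> (Restr E X)\<^sup>*" for y
    using that
  proof induction
    case (step y z)
    then have "y \<in> ?C" "z \<in> ?C" by (auto simp: component_def intro: rtrancl.rtrancl_into_rtrancl)
    with step show ?case by (auto intro: rtrancl.rtrancl_into_rtrancl)
  qed simp
  have "sym ((Restr E ?C)\<^sup>*)"
    using assms by (intro sym_rtrancl) (auto simp: sym_def)
  then have "(y, x) \<in> (Restr E ?C)\<^sup>*" if "(x, y) \<in> (Restr E X)\<^sup>*" for y
    using * that by (blast dest: symD)
  with * show ?thesis
    unfolding conn_def component_def by (blast intro: rtrancl_trans)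
qed

lemma comp_subset: "x \<in> X \<Longrightarrow> component E X x \<subseteq> X"
  by (auto simp: component_def elim: rtranclE)

lemma comp_self: "x \<in> component E X x"
  by (simp add: component_def)

lemma conn_subset_comp:
  assumes "conn E D" "D \<subseteq> X" "x \<in> D" shows "D \<subseteq> component E X x"
proof
  fix y assume "y \<in> D"
  then have "(x, y) \<in> (Restr E D)\<^sup>*" using assms by (auto simp: conn_def)
  moreover have "Restr E D \<subseteq> Restr E X" using assms by auto
  ultimately show "y \<in> component E X x" unfolding component_def using rtrancl_mono by blast
qed

lemma conn_empty [simp]: "conn E {}"
  by (simp add: conn_def)

lemma conn_Un:
  assumes "conn E C" "conn E D" "z \<in> C" "z \<in> D"
  shows "conn E (C \<union> D)"
proof -
  have C: "(x, y) \<in> (Restr E (C \<union> D))\<^sup>*" if "x \<in> C" "y \<in> C" for x y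
    using that assms(1) rtrancl_mono[of "Restr E C" "Restr E (C \<union> D)"] by (auto simp: conn_def)
  have D: "(x, y) \<in> (Restr E (C \<union> D))\<^sup>*" if "x \<in> D" "y \<in> D" for x y
    using that assms(2) rtrancl_mono[of "Restr E D" "Restr E (C \<union> D)"] by (auto simp: conn_def)
  show ?thesis
    unfolding conn_def using C D assms(3,4) by (blast intro: rtrancl_trans)
qed

lemma conn_edge:
  assumes "sym E" "(x, y) \<in> E" shows "conn E {x, y}"
proof -
  have "(x, y) \<in> Restr E {x, y}" "(y, x) \<in> Restr E {x, y}" using assms by (auto simp: sym_def)
  then show ?thesis unfolding conn_def by blast
qed

lemma conn_insert:
  assumes "sym E" "conn E C" "x \<in> C" "(x, u) \<in> E" shows "conn E (insert u C)"
proof -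
  have "conn E (C \<union> {x, u})" using assms conn_edge[OF assms(1,4)] by (intro conn_Un[of E C _ x]) auto
  moreover have "C \<union> {x, u} = insert u C" using assms by auto
  ultimately show ?thesis by simp
qed

lemma component_maximal:
  assumes "sym E" "x \<in> X" "conn E D" "D \<subseteq> X" "D \<inter> component E X x \<noteq> {}"
  shows "D \<subseteq> component E X x"
proof -
  obtain z where "z \<in> component E X x" "z \<in> D" using assms by auto
  then have "conn E (component E X x \<union> D)" using conn_comp assms(1,3) by (intro conn_Un)
  then have "component E X x \<union> D \<subseteq> component E X x"
    using comp_subset[OF assms(2)] assms(4) comp_self[of x E X] by (intro conn_subset_comp) auto
  then show ?thesis by simp
qed

lemma conn_exit:
  assumes "conn E C" "D \<subseteq> C" "D \<noteq> {}" "D \<noteq> C"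
  obtains x y where "x \<in> D" "y \<in> C - D" "(x, y) \<in> E"
proof (rule ccontr)
  assume no: "\<not> thesis"
  obtain a where a: "a \<in> D" using assms by auto
  obtain b where b: "b \<in> C - D" using assms by auto
  have "(a, b) \<in> (Restr E C)\<^sup>*" using assms a b by (auto simp: conn_def)
  then have "b \<in> D"
  proof induction
    case (step y z) then show ?case using no that by auto
  qed (use a in auto)
  with b show False by auto
qed

section \<open>Shortest walks and induced paths\<close>

lemma relpow_shortest:
  assumes "(x, y) \<in> R\<^sup>*"
  obtains f n where "f 0 = x" "f n = y" "\<And>i. i < n \<Longrightarrow> (f i, f (Suc i)) \<in> R"
    "\<And>i j. i < j \<Longrightarrow> j \<le> n \<Longrightarrow> f i \<noteq> f j"
    "\<And>i j. Suc i < j \<Longrightarrow> j \<le> n \<Longrightarrow> (f i, f j) \<notin> R"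
proof -
  define n where "n = (LEAST n. (x, y) \<in> R ^^ n)"
  have n: "(x, y) \<in> R ^^ n" unfolding n_def using assms by (metis LeastI rtrancl_power)
  have min: "n \<le> n'" if "(x, y) \<in> R ^^ n'" for n' unfolding n_def using that by (rule Least_le)
  obtain f where f: "f 0 = x" "f n = y" "\<And>i. i < n \<Longrightarrow> (f i, f (Suc i)) \<in> R"
    using n by (auto simp: relpow_fun_conv)
  have seg: "(f i, f j) \<in> R ^^ (j - i)" if "i \<le> j" "j \<le> n" for i j
    unfolding relpow_fun_conv
    by (rule exI[of _ "\<lambda>l. f (i + l)"]) (use that f in auto)
  \<comment> \<open>Replacing the segment from \<open>i\<close> to \<open>j\<close> by a walk of
    length \<open>d\<close> cannot shorten the whole walk; \<open>d = 0\<close> will exclude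
    repetitions and \<open>d = 1\<close> shortcuts.\<close>
  have short: "n \<le> i + d + (n - j)" if "i \<le> j" "j \<le> n" "(f i, f j) \<in> R ^^ d" for i j d
  proof -
    have "(x, f i) \<in> R ^^ i" "(f j, y) \<in> R ^^ (n - j)"
      using seg[of 0 i] seg[of j n] that f by auto
    then have "(x, y) \<in> R ^^ (i + d + (n - j))"
      using that(3) by (auto simp: relpow_add)
    then show ?thesis by (rule min)
  qed
  show thesis
  proof (rule that[OF f])
    show "f i \<noteq> f j" if "i < j" "j \<le> n" for i j
      using short[of i j 0] that by auto
    show "(f i, f j) \<notin> R" if "Suc i < j" "j \<le> n" for i j
    proof
      assume "(f i, f j) \<in> R"
      then show False using short[of i j 1] that by auto
    qed
  qed
qed

lemma induced_path_prefix: "induced_path E f n \<Longrightarrow> m \<le> n \<Longrightarrow> induced_path E f m"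
  by (auto simp: induced_path_def inj_on_def)

lemma shortest_induced_path:
  assumes "sym E" "irrefl E" "(x, y) \<in> (Restr E X)\<^sup>*" "x \<in> X"
  obtains f n where "f 0 = x" "f n = y" "f ` {..n} \<subseteq> X" "induced_path E f (Suc n)"
proof -
  obtain f n where f: "f 0 = x" "f n = y" "\<And>i. i < n \<Longrightarrow> (f i, f (Suc i)) \<in> Restr E X"
    "\<And>i j. i < j \<Longrightarrow> j \<le> n \<Longrightarrow> f i \<noteq> f j"
    "\<And>i j. Suc i < j \<Longrightarrow> j \<le> n \<Longrightarrow> (f i, f j) \<notin> Restr E X"
    using relpow_shortest[OF assms(3)] by metis
  have X: "f i \<in> X" if "i \<le> n" for i
    using that f(1) assms(4) f(3)[of "i - 1"] by (cases i) auto
  \<comment> \<open>Shortcuts are excluded inside \<open>X\<close> only, but the whole path lies in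
    \<open>X\<close>.\<close>
  have E: "(f i, f j) \<in> E \<longleftrightarrow> j = Suc i" if "i < j" "j \<le> n" for i j
    using f(3)[of i] f(5)[of i j] that X[of i] X[of j] by (cases "j = Suc i") auto
  have "inj_on f {..<Suc n}"
    by (rule linorder_inj_onI) (use f(4) in auto)
  moreover have "(f i, f j) \<in> E \<longleftrightarrow> i = Suc j \<or> j = Suc i" if "i < Suc n" "j < Suc n" for i j
  proof (cases i j rule: linorder_cases)
    case less then show ?thesis using E[of i j] that by auto
  next
    case equal then show ?thesis using assms(2) by (auto simp: irrefl_def)
  next
    case greater then show ?thesis using E[of j i] that assms(1) by (auto simp: sym_def)
  qed
  ultimately have "induced_path E f (Suc n)" by (auto simp: induced_path_def)
  with f X show thesis by (intro that[of f n]) auto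
qed

section \<open>Ramsey numbers and induced bicliques\<close>

text \<open>Induction on \<open>s\<close>. A vertex outside a maximal clique \<open>K\<close> misses
  some \<open>x \<in> K\<close>, so \<open>K\<close> and at most \<open>w\<close> sets of
  non-neighbours cover \<open>U\<close>; an independent set in one of these can be enlarged by its
  \<open>x\<close>.\<close>

lemma polynomial_Ramsey:
  assumes "finite U" "sym E" "irrefl E"
    and "\<And>K. K \<subseteq> U \<Longrightarrow> clique_set E K \<Longrightarrow> card K \<le> w"
    and "\<And>T. T \<subseteq> U \<Longrightarrow> indep E T \<Longrightarrow> card T \<noteq> s"
  shows "card U < (w + 1) ^ s"
  using assms
proof (induction s arbitrary: U)
  case 0
  from "0.prems"(5)[of "{}"] show ?case by (simp add: indep_def)
next
  case (Suc s)
  define \<K> where "\<K> = {K. K \<subseteq> U \<and> clique_set E K}"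
  have fin: "finite \<K>" unfolding \<K>_def using Suc.prems(1) by auto
  have ne: "{} \<in> \<K>" by (simp add: \<K>_def clique_set_def)
  obtain K where K: "K \<in> \<K>" and Kmax: "\<And>K'. K' \<in> \<K> \<Longrightarrow> K \<subseteq> K' \<Longrightarrow> K' = K"
    using finite_has_maximal[OF fin] ne by (metis empty_iff)
  define N where "N x = {y \<in> U. y \<noteq> x \<and> (x, y) \<notin> E}" for x
  have cover: "U \<subseteq> (\<Union>x\<in>K. insert x (N x))"
  proof
    fix y assume y: "y \<in> U"
    show "y \<in> (\<Union>x\<in>K. insert x (N x))"
    proof (rule ccontr)
      assume no: "\<not> ?thesis"
      then have "y \<notin> K" "\<forall>x\<in>K. (x, y) \<in> E" using y by (auto simp: N_def)
      then have "insert y K \<in> \<K>"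
        using K y \<open>sym E\<close> by (auto simp: \<K>_def clique_set_def sym_def)
      with Kmax \<open>y \<notin> K\<close> show False by blast
    qed
  qed
  have finK: "finite K" "card K \<le> w"
    using K Suc.prems(1,4) by (auto simp: \<K>_def intro: finite_subset)
  have N: "card (N x) < (w + 1) ^ s" if "x \<in> K" for x
  proof (rule Suc.IH)
    show "finite (N x)" using Suc.prems(1) by (auto simp: N_def)
    show "card K' \<le> w" if "K' \<subseteq> N x" "clique_set E K'" for K'
      using Suc.prems(4) that by (auto simp: N_def)
    show "card T \<noteq> s" if T: "T \<subseteq> N x" "indep E T" for T
    proof
      assume "card T = s"
      have xT: "x \<notin> T" "finite T" using T Suc.prems(1) by (auto simp: N_def intro: finite_subset)
      have "insert x T \<subseteq> U" using T K that(1) \<open>x \<in> K\<close> by (auto simp: N_def \<K>_def)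
      moreover have "indep E (insert x T)"
        using T \<open>sym E\<close> \<open>irrefl E\<close> unfolding indep_def N_def sym_def irrefl_def by blast
      ultimately show False using Suc.prems(5) xT \<open>card T = s\<close> by (metis card_insert_disjoint)
    qed
  qed (use Suc.prems in auto)
  have finN: "finite (N x)" for x using Suc.prems(1) by (auto simp: N_def)
  have "card U \<le> card (\<Union>x\<in>K. insert x (N x))"
    by (intro card_mono cover) (use finK finN in auto)
  also have "\<dots> \<le> (\<Sum>x\<in>K. card (insert x (N x)))" using finK by (intro card_UN_le) auto
  \<comment> \<open>The strict bound of the induction hypothesis leaves room for \<open>x\<close>
    itself.\<close>
  also have "\<dots> \<le> (\<Sum>x\<in>K. (w + 1) ^ s)"
  proof (rule sum_mono)
    fix x assume "x \<in> K"
    have "card (insert x (N x)) \<le> Suc (card (N x))" by (rule card_insert_le_m1) auto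
    then show "card (insert x (N x)) \<le> (w + 1) ^ s" using N[OF \<open>x \<in> K\<close>] by linarith
  qed
  also have "\<dots> \<le> w * (w + 1) ^ s" using finK by simp
  also have "\<dots> < (w + 1) ^ Suc s" by simp
  finally show ?case .
qed

lemma double_count:
  assumes "finite A" "finite B"
  shows "(\<Sum>a\<in>A. card {b \<in> B. P a b}) = (\<Sum>b\<in>B. card {a \<in> A. P a b})"
proof -
  have "(\<Sum>a\<in>A. card {b \<in> B. P a b}) = (\<Sum>a\<in>A. \<Sum>b\<in>B. if P a b then 1 else 0)"
    using assms by (simp add: sum.If_cases Int_def)
  also have "\<dots> = (\<Sum>b\<in>B. \<Sum>a\<in>A. if P a b then 1 else 0)" by (rule sum.swap)
  also have "\<dots> = (\<Sum>b\<in>B. card {a \<in> A. P a b})"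
    using assms by (simp add: sum.If_cases Int_def)
  finally show ?thesis .
qed


text \<open>
  Double counting produces many vertices of \<open>Q\<close> with at least \<open>R\<close> neighbours in \<open>W\<close>, hence with an
  independent \<open>s\<close>-set of neighbours in \<open>W\<close>.  As \<open>s\<close> is fixed, there are only polynomially many
  candidates for that set, so that one of them is shared by \<open>R\<close> vertices of \<open>Q\<close>.
\<close>
lemma few_high_degree_vertices:
  fixes c k w s :: nat
  defines "R \<equiv> (w + 1) ^ s"
  defines "M \<equiv> 2 * c * R"
  defines "t \<equiv> 2 * M ^ s * R"
  assumes "finite Q" "finite W" "Q \<inter> W = {}" "sym E" "irrefl E" "c > 0"
    and clique: "\<And>K. K \<subseteq> Q \<union> W \<Longrightarrow> clique_set E K \<Longrightarrow> card K \<le> w"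
    and biclique: "\<And>S T. S \<subseteq> Q \<union> W \<Longrightarrow> T \<subseteq> Q \<union> W \<Longrightarrow> card S = s \<Longrightarrow> card T = s \<Longrightarrow> \<not> induced_biclique E S T"
    and Q: "card Q \<le> c * t"
    and W: "\<And>z. z \<in> W \<Longrightarrow> t \<le> card {q \<in> Q. (q, z) \<in> E}"
  shows "card W < M"
proof (rule ccontr)
  assume "\<not> card W < M"
  \<comment> \<open>Cutting \<open>W\<close> down to exactly \<open>M\<close> vertices leaves at
    most \<open>M ^ s\<close> candidates for the shared set.\<close>
  then obtain W' where W': "W' \<subseteq> W" "card W' = M" by (meson not_less obtain_subset_with_card_n)
  have finW': "finite W'" using W' \<open>finite W\<close> finite_subset by blast
  have "R > 0" "M > 0" using \<open>c > 0\<close> by (auto simp: R_def M_def)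
  define D where "D q = {z \<in> W'. (q, z) \<in> E}" for q
  define Q1 where "Q1 = {q \<in> Q. R \<le> card (D q)}"
  have finQ1: "finite Q1" "Q1 \<subseteq> Q" using \<open>finite Q\<close> by (auto simp: Q1_def)
  have indep_ex: "\<exists>T\<subseteq>U. indep E T \<and> card T = s"
    if "U \<subseteq> Q \<union> W" "R \<le> card U" for U
  proof (rule ccontr)
    assume no: "\<not> ?thesis"
    have "card U < (w + 1) ^ s"
    proof (rule polynomial_Ramsey[OF _ \<open>sym E\<close> \<open>irrefl E\<close>])
      show "finite U" using that \<open>finite Q\<close> \<open>finite W\<close> finite_subset by blast
    qed (use clique that no in auto)
    with that(2) show False by (simp add: R_def)
  qed
  have "M * t \<le> (\<Sum>z\<in>W'. card {q \<in> Q. (q, z) \<in> E})"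
  proof -
    have "(\<Sum>z\<in>W'. t) \<le> (\<Sum>z\<in>W'. card {q \<in> Q. (q, z) \<in> E})"
      by (rule sum_mono) (use W W'(1) in auto)
    then show ?thesis by (simp add: W'(2))
  qed
  also have "\<dots> = (\<Sum>q\<in>Q. card (D q))"
    unfolding D_def by (rule double_count[OF finW' \<open>finite Q\<close>])
  also have "\<dots> \<le> (\<Sum>q\<in>Q. (if q \<in> Q1 then M else 0) + R)"
  proof (rule sum_mono)
    fix q assume "q \<in> Q"
    have "card (D q) \<le> M" unfolding W'(2)[symmetric] D_def by (rule card_mono) (use finW' in auto)
    then show "card (D q) \<le> (if q \<in> Q1 then M else 0) + R"
      using \<open>q \<in> Q\<close> by (auto simp: Q1_def)
  qed
  also have "\<dots> = card Q1 * M + card Q * R"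
  proof -
    have "Q \<inter> {q. q \<in> Q1} = Q1" using finQ1 by auto
    then show ?thesis using \<open>finite Q\<close> by (simp add: sum.distrib sum.If_cases)
  qed
  \<comment> \<open>The summands \<open>R\<close> add up to at most half of \<open>M * t\<close>,
    because \<open>M = 2 * c * R\<close>. The other half must come from \<open>Q1\<close>.\<close>
  also have "2 * (\<dots>) \<le> 2 * (card Q1 * M) + M * t"
    using mult_right_mono[OF Q, of "2 * R"] by (simp add: M_def algebra_simps)
  finally have "M * t \<le> M * (2 * card Q1)" by (simp add: algebra_simps)
  then have Q1_large: "M ^ s * R \<le> card Q1" using \<open>M > 0\<close> by (simp add: t_def)
  have "\<forall>q\<in>Q1. \<exists>T\<subseteq>D q. indep E T \<and> card T = s"
  proof
    fix q assume "q \<in> Q1"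
    moreover have "D q \<subseteq> Q \<union> W" using W' by (auto simp: D_def)
    ultimately show "\<exists>T\<subseteq>D q. indep E T \<and> card T = s" using indep_ex by (auto simp: Q1_def)
  qed
  then obtain T where T: "\<And>q. q \<in> Q1 \<Longrightarrow> T q \<subseteq> D q \<and> indep E (T q) \<and> card (T q) = s"
    by metis
  define \<T> where "\<T> = {T. T \<subseteq> W' \<and> card T = s}"
  have fin\<T>: "finite \<T>" using finW' by (auto simp: \<T>_def)
  have T_in: "T ` Q1 \<subseteq> \<T>" using T by (fastforce simp: \<T>_def D_def)
  have card\<T>: "card \<T> \<le> M ^ s"
    unfolding \<T>_def n_subsets[OF finW'] W'(2)
    by (cases "s \<le> M") (simp_all add: binomial_le_pow binomial_eq_0)
  have "\<exists>T0\<in>\<T>. R \<le> card {q \<in> Q1. T q = T0}"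
  proof (rule ccontr)
    assume "\<not> ?thesis"
    then have less: "card {q \<in> Q1. T q = T0} \<le> R - 1" if "T0 \<in> \<T>" for T0
      using that by fastforce
    have "card Q1 = (\<Sum>q\<in>Q1. card {T0\<in>\<T>. T q = T0})"
    proof -
      have "{T0\<in>\<T>. T q = T0} = {T q}" if "q \<in> Q1" for q using that T_in by auto
      then show ?thesis by simp
    qed
    also have "\<dots> = (\<Sum>T0\<in>\<T>. card {q \<in> Q1. T q = T0})" by (rule double_count[OF finQ1(1) fin\<T>])
    also have "\<dots> \<le> (\<Sum>T0\<in>\<T>. R - 1)" by (rule sum_mono) (rule less)
    also have "\<dots> \<le> M ^ s * (R - 1)" using card\<T> by simp
    also have "\<dots> < M ^ s * R" using \<open>R > 0\<close> \<open>M > 0\<close> by simp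
    finally show False using Q1_large by simp
  qed
  then obtain T0 where T0: "T0 \<in> \<T>" "R \<le> card {q \<in> Q1. T q = T0}" by auto
  \<comment> \<open>Ramsey once more, now among the vertices of \<open>Q\<close> that share
    \<open>T0\<close>.\<close>
  obtain S where S: "S \<subseteq> {q \<in> Q1. T q = T0}" "indep E S" "card S = s"
    using indep_ex[OF _ T0(2)] finQ1 by auto
  show False
  proof (cases "s = 0")
    case True
    then show ?thesis using biclique[of "{}" "{}"] by (auto simp: induced_biclique_def indep_def)
  next
    case False
    \<comment> \<open>Independence of \<open>T0\<close> is inherited from some \<open>T q\<close>,
      which takes an element of \<open>S\<close>.\<close>
    then obtain q where "q \<in> S" using S(3) by fastforce
    then have "indep E T0" using S T by auto
    moreover have "S \<times> T0 \<subseteq> E" using S T by (force simp: D_def)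
    moreover have "S \<inter> T0 = {}" using S(1) T0(1) W'(1) finQ1(2) \<open>Q \<inter> W = {}\<close> by (fastforce simp: \<T>_def)
    ultimately have "induced_biclique E S T0"
      using S by (auto simp: induced_biclique_def)
    then show False using biclique[of S T0] S T0(1) W'(1) finQ1(2) by (fastforce simp: \<T>_def)
  qed
qed

section \<open>Balanced separators\<close>

lemma induced_path_extend:
  assumes "induced_path E f (Suc n)" "sym E" "irrefl E" "u \<notin> f ` {..n}"
    "(f n, u) \<in> E" "\<And>i. i < n \<Longrightarrow> (f i, u) \<notin> E"
  shows "induced_path E (f(Suc n := u)) (Suc (Suc n))"
proof -
  have "inj_on (f(Suc n := u)) {..<Suc (Suc n)}"
    using assms(1,4) unfolding induced_path_def lessThan_Suc[of "Suc n"] lessThan_Suc_atMost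
    by (auto simp: inj_on_def)
  moreover have "((f(Suc n := u)) i, (f(Suc n := u)) j) \<in> E \<longleftrightarrow> i = Suc j \<or> j = Suc i"
    if "i < Suc (Suc n)" "j < Suc (Suc n)" for i j
  proof -
    have u: "(f i, u) \<in> E \<longleftrightarrow> i = n" if "i < Suc n" for i
      using assms(5,6) that less_Suc_eq by auto
    have u': "(u, f i) \<in> E \<longleftrightarrow> i = n" if "i < Suc n" for i
      using u[OF that] \<open>sym E\<close> by (auto simp: sym_def)
    show ?thesis
      using that assms(1,3) u[of i] u'[of j]
      by (cases "i = Suc n"; cases "j = Suc n") (auto simp: induced_path_def irrefl_def)
  qed
  ultimately show ?thesis unfolding induced_path_def by blast
qed

text \<open>
  The path grows into a big component that only its last vertex sees; it stops when the closed
  neighbourhood of the path meets all big connected sets.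
\<close>
lemma Gyarfas_path:
  assumes "sym E" "irrefl E" and C0: "conn E C0" "big C0"
    and big_mono: "\<And>C D. big C \<Longrightarrow> C \<subseteq> D \<Longrightarrow> big D"
    and big_meet: "\<And>C D. big C \<Longrightarrow> big D \<Longrightarrow> C \<inter> D \<noteq> {}"
    and no_path: "\<And>f. \<not> induced_path E f k"
  obtains P where "P \<subseteq> C0" "card P \<le> k" "\<And>D. conn E D \<Longrightarrow> D \<subseteq> C0 - P - E `` P \<Longrightarrow> \<not> big D"
proof (rule ccontr)
  assume no: "\<not> thesis"
  note found = that
  have length: "Suc n \<le> k" if "induced_path E f (Suc n)" for f n
    using no_path that induced_path_prefix[OF that, of k] by (metis not_less_eq_eq nle_le)
  have step0: "\<exists>D. conn E D \<and> D \<subseteq> C0 - P - E `` P \<and> big D" if "P \<subseteq> C0" "card P \<le> k" for P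
    using no that found[of P] by blast
  have comp: "conn E (component E X x)" "component E X x \<subseteq> X" "big (component E X x)"
    "\<And>D'. conn E D' \<Longrightarrow> D' \<subseteq> X \<Longrightarrow> D' \<inter> component E X x \<noteq> {} \<Longrightarrow> D' \<subseteq> component E X x"
    if "conn E D" "big D" "D \<subseteq> X" "x \<in> D" for D X x
  proof -
    show "conn E (component E X x)" using \<open>sym E\<close> by (rule conn_comp)
    show "component E X x \<subseteq> X" using that by (intro comp_subset) auto
    show "big (component E X x)" using that conn_subset_comp big_mono by metis
    show "D' \<subseteq> component E X x" if "conn E D'" "D' \<subseteq> X" "D' \<inter> component E X x \<noteq> {}" for D'
      using component_maximal[OF \<open>sym E\<close> _ that] \<open>D \<subseteq> X\<close> \<open>x \<in> D\<close> by auto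
  qed
  \<comment> \<open>\<open>C\<close> is a big component of \<open>C0\<close> after removal of the
    path and of the neighbours of all its vertices but the last. The clause on \<open>D\<close> is
    the maximality of this component; it forces the big connected set found in the next round into
    \<open>C\<close>.\<close>
  define inv where "inv n f C \<longleftrightarrow> induced_path E f (Suc n) \<and> f ` {..n} \<subseteq> C0 \<and> C \<subseteq> C0 \<and> conn E C \<and> big C \<and>
      f ` {..n} \<inter> C = {} \<and> (\<exists>y\<in>C. (f n, y) \<in> E) \<and> (\<forall>i<n. \<forall>y\<in>C. (f i, y) \<notin> E) \<and>
      (\<forall>D. conn E D \<longrightarrow> D \<subseteq> C0 - f ` {..n} - E `` (f ` {..<n}) \<longrightarrow> D \<inter> C \<noteq> {} \<longrightarrow> D \<subseteq> C)" for n f C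
  \<comment> \<open>Under the negated goal every path so far leaves a big connected set beyond its
    closed neighbourhood, so it can be extended, finally to \<open>k + 1\<close> vertices.\<close>
  have "\<exists>f C. inv n f C" for n
  proof (induction n)
    case 0
    obtain a where a: "a \<in> C0" using big_meet[OF C0(2) C0(2)] by auto
    have pa: "induced_path E (\<lambda>_. a) (Suc 0)"
      using \<open>irrefl E\<close> by (auto simp: induced_path_def irrefl_def inj_on_def)
    have "card {a} \<le> k" using length[OF pa] by simp
    then obtain D where D: "conn E D" "D \<subseteq> C0 - {a} - E `` {a}" "big D"
      using step0[of "{a}"] a by auto
    obtain x where x: "x \<in> D" using big_meet[OF D(3) D(3)] by auto
    have "D \<subseteq> C0 - {a}" using D by auto
    note C = comp[OF D(1,3) this x]
    define C where "C = component E (C0 - {a}) x"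
    have "C \<noteq> {}" "C \<subseteq> C0" "C \<noteq> C0" using C(2) a comp_self[of x E "C0 - {a}"] by (auto simp: C_def)
    then obtain y u where yu: "y \<in> C" "u \<in> C0 - C" "(y, u) \<in> E"
      using conn_exit[OF C0(1), of C] by metis
    \<comment> \<open>Any other \<open>u\<close> would belong to \<open>C0 - {a}\<close> and be
      absorbed by the component.\<close>
    have "u = a"
    proof (rule ccontr)
      assume "u \<noteq> a"
      then have "insert u C \<subseteq> C"
        using C(2) yu conn_insert[OF \<open>sym E\<close> _ yu(1,3)] C(1) C(4)[of "insert u C"]
        by (auto simp: C_def)
      then show False using yu by auto
    qed
    then have "\<exists>y\<in>C. (a, y) \<in> E" using yu(1) symD[OF \<open>sym E\<close> yu(3)] by blast
    moreover have "conn E C" "big C" "{a} \<inter> C = {}" using C(1-3) by (auto simp: C_def)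
    moreover have "D' \<subseteq> C" if "conn E D'" "D' \<subseteq> C0 - {a}" "D' \<inter> C \<noteq> {}" for D'
      using C(4)[of D'] that by (simp add: C_def)
    moreover have "(\<lambda>_::nat. a) ` {..0} = {a}" by auto
    ultimately have "inv 0 (\<lambda>_. a) C"
      using pa a \<open>C \<subseteq> C0\<close> by (simp add: inv_def)
    then show ?case by blast
  next
    case (Suc n)
    then obtain f C where "inv n f C" by blast
    then have fC: "induced_path E f (Suc n)" "f ` {..n} \<subseteq> C0" "C \<subseteq> C0" "conn E C" "big C"
      "f ` {..n} \<inter> C = {}" "\<exists>y\<in>C. (f n, y) \<in> E" "\<forall>i<n. \<forall>y\<in>C. (f i, y) \<notin> E"
      and C_max: "\<And>D. conn E D \<Longrightarrow> D \<subseteq> C0 - f ` {..n} - E `` (f ` {..<n}) \<Longrightarrow> D \<inter> C \<noteq> {} \<Longrightarrow> D \<subseteq> C"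
      by (simp_all add: inv_def)
    have "card (f ` {..n}) \<le> k"
      using length[OF fC(1)] card_image_le[of "{..n}" f] by simp
    then obtain D where D: "conn E D" "D \<subseteq> C0 - f ` {..n} - E `` (f ` {..n})" "big D"
      using step0[OF fC(2)] by auto
    have nbr: "E `` (f ` {..<n}) \<subseteq> E `` (f ` {..n})" "E `` {f n} \<subseteq> E `` (f ` {..n})"
      by (auto intro!: Image_mono)
    have "D \<subseteq> C"
      by (rule C_max[OF D(1)]) (use D(2) nbr(1) big_meet[OF D(3) fC(5)] in blast)+
    define X where "X = C - E `` {f n}"
    have DX: "D \<subseteq> X" using D(2) nbr(2) \<open>D \<subseteq> C\<close> unfolding X_def by blast
    obtain x where x: "x \<in> D" using big_meet[OF D(3) D(3)] by auto
    note C' = comp[OF D(1,3) DX x]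
    define C' where "C' = component E X x"
    have "C' \<noteq> {}" "C' \<subseteq> C" "C' \<noteq> C"
      using C'(2) comp_self[of x E X] fC(7) by (auto simp: C'_def X_def)
    then obtain y u where yu: "y \<in> C'" "u \<in> C - C'" "(y, u) \<in> E"
      using conn_exit[OF fC(4), of C'] by metis
    \<comment> \<open>Otherwise \<open>u\<close> would lie in \<open>X\<close> and be absorbed by
      \<open>C'\<close>. So \<open>u\<close> sees the last path vertex, and as a member of
      \<open>C\<close> it sees no earlier one: it is the next vertex.\<close>
    have fu: "(f n, u) \<in> E"
    proof (rule ccontr)
      assume "(f n, u) \<notin> E"
      then have "insert u C' \<subseteq> C'"
        using C'(2) yu conn_insert[OF \<open>sym E\<close> _ yu(1,3)] C'(1) C'(4)[of "insert u C'"]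
        by (auto simp: C'_def X_def)
      then show False using yu by auto
    qed
    define g where "g = f(Suc n := u)"
    have g: "g ` {..Suc n} = insert u (f ` {..n})" "g ` {..<Suc n} = f ` {..n}" "g (Suc n) = u"
      by (auto simp: g_def atMost_Suc lessThan_Suc_atMost)
    have gf: "g i = f i" if "i \<le> n" for i using that by (auto simp: g_def)
    have "induced_path E g (Suc (Suc n))"
      unfolding g_def
      by (rule induced_path_extend[OF fC(1) \<open>sym E\<close> \<open>irrefl E\<close> _ fu]) (use fC(6,8) yu in auto)
    moreover have "g ` {..Suc n} \<subseteq> C0" using g fC yu by auto
    moreover have "C' \<subseteq> C0" "conn E C'" "big C'" using C' fC \<open>C' \<subseteq> C\<close> by (auto simp: C'_def)
    moreover have "g ` {..Suc n} \<inter> C' = {}" using g fC yu \<open>C' \<subseteq> C\<close> by auto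
    moreover have "\<exists>y\<in>C'. (g (Suc n), y) \<in> E" using yu(1) symD[OF \<open>sym E\<close> yu(3)] g(3) by auto
    moreover have "\<forall>i<Suc n. \<forall>y\<in>C'. (g i, y) \<notin> E"
      using fC(8) C'(2)[folded C'_def] \<open>C' \<subseteq> C\<close> gf by (auto simp: less_Suc_eq X_def)
    moreover have "D' \<subseteq> C'"
      if "conn E D'" "D' \<subseteq> C0 - g ` {..Suc n} - E `` (g ` {..<Suc n})" "D' \<inter> C' \<noteq> {}" for D'
    proof -
      have D': "D' \<subseteq> C0 - insert u (f ` {..n}) - E `` (f ` {..n})"
        using that(2) unfolding g(1,2) .
      have "D' \<inter> C \<noteq> {}" using that(3) \<open>C' \<subseteq> C\<close> by blast
      moreover have "D' \<subseteq> C0 - f ` {..n} - E `` (f ` {..<n})" using D' nbr(1) by blast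
      ultimately have "D' \<subseteq> C" using C_max[OF that(1)] by simp
      then have "D' \<subseteq> X" using D' nbr(2) unfolding X_def by blast
      with C'(4)[folded C'_def] that(1,3) show ?thesis by simp
    qed
    ultimately have "inv (Suc n) g C'" by (simp add: inv_def)
    then show ?case by blast
  qed
  then obtain f C where "inv k f C" by blast
  then have "induced_path E f (Suc k)" by (simp add: inv_def)
  from length[OF this] show False by simp
qed

lemma induced_path_walk:
  assumes "induced_path E f (Suc n)" "f ` {..n} \<subseteq> X"
  shows "(f 0, f n) \<in> (Restr E X) ^^ n"
  unfolding relpow_fun_conv
proof (intro exI[of _ f] conjI allI impI refl)
  fix i assume "i < n"
  then have "f i \<in> X" "f (Suc i) \<in> X" using subsetD[OF assms(2)] by auto
  then show "(f i, f (Suc i)) \<in> Restr E X" using assms(1) \<open>i < n\<close> by (simp add: induced_path_def)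
qed

text \<open>
  If there is no small balanced separator, then removing Gyarfas paths one after the other gives many
  disjoint paths \<open>Ps i\<close> with at most \<open>k\<close> vertices whose neighbourhoods are balanced separators.  After
  removing also the few vertices that see a fraction \<open>1 / (3 k)\<close> of the paths, a connected set \<open>C\<close> with
  most of \<open>A\<close> remains.  Averaging gives \<open>x\<close> and \<open>y\<close> in \<open>C\<close> separated by a third of the neighbourhoods, so
  some vertex of a shortest path from \<open>x\<close> to \<open>y\<close> in \<open>C\<close>, which has at most \<open>k\<close> vertices, sees too many of
  the paths.
\<close>
lemma balanced_separator:
  fixes k w s :: nat
  defines "R \<equiv> (w + 1) ^ s"
  defines "M \<equiv> 2 * (3 * k\<^sup>2) * R"
  defines "t \<equiv> 2 * M ^ s * R"
  assumes "finite V" "sym E" "irrefl E"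
    and no_path: "\<And>f. \<not> induced_path E f k"
    and clique: "\<And>K. K \<subseteq> V \<Longrightarrow> clique_set E K \<Longrightarrow> card K \<le> w"
    and biclique: "\<And>S T. S \<subseteq> V \<Longrightarrow> T \<subseteq> V \<Longrightarrow> card S = s \<Longrightarrow> card T = s \<Longrightarrow> \<not> induced_biclique E S T"
    and "A \<subseteq> V"
  obtains X where "X \<subseteq> V" "card X \<le> 3 * k\<^sup>2 * t + M"
    "\<And>C. conn E C \<Longrightarrow> C \<subseteq> V - X \<Longrightarrow> 4 * card (C \<inter> A) \<le> 3 * card A"
proof (rule ccontr)
  assume "\<not> thesis"
  with that have no_sep: "\<exists>C. conn E C \<and> C \<subseteq> V - X \<and> 3 * card A < 4 * card (C \<inter> A)"
    if "X \<subseteq> V" "card X \<le> 3 * k\<^sup>2 * t + M" for X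
    using that by (metis not_le)
  have "k > 0" using no_path by (rule_tac ccontr) (auto simp: induced_path_def)
  have "t > 0" using \<open>k > 0\<close> by (simp add: t_def M_def R_def)
  \<comment> \<open>The number of paths: a third of it is \<open>k * t\<close>, while a path on at
    most \<open>k\<close> vertices, each seeing fewer than \<open>t\<close> of them, meets fewer
    than \<open>k * t\<close> neighbourhoods.\<close>
  define m where "m = 3 * k * t"
  have m: "3 * k\<^sup>2 * t = k * m" by (simp add: m_def power2_eq_square)
  have "m > 0" using \<open>k > 0\<close> \<open>t > 0\<close> by (simp add: m_def)
  have finA: "finite A" using \<open>A \<subseteq> V\<close> \<open>finite V\<close> finite_subset by blast
  \<comment> \<open>One half makes any two big sets meet. The gap to the three quarters in
    \<open>no_sep\<close> is spent in the estimate of \<open>U\<close> below.\<close>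
  define big where "big D \<longleftrightarrow> card A < 2 * card (D \<inter> A)" for D
  have big_mono: "big D" if "big C" "C \<subseteq> D" for C D
  proof -
    have "card (C \<inter> A) \<le> card (D \<inter> A)" by (rule card_mono) (use that finA in auto)
    with that show ?thesis by (simp add: big_def)
  qed
  have big_meet: "C \<inter> D \<noteq> {}" if "big C" "big D" for C D
  proof
    assume "C \<inter> D = {}"
    then have "card (C \<inter> A) + card (D \<inter> A) = card ((C \<inter> A) \<union> (D \<inter> A))"
      using finA by (intro card_Un_disjoint[symmetric]) auto
    also have "\<dots> \<le> card A" by (rule card_mono) (use finA in auto)
    finally show False using that by (simp add: big_def)
  qed
  have "\<exists>Ps. \<forall>i<j. Ps i \<subseteq> V - \<Union>(Ps ` {..<i}) \<and> card (Ps i) \<le> k \<and>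
      (\<forall>D. conn E D \<longrightarrow> D \<subseteq> V - \<Union>(Ps ` {..i}) - E `` Ps i \<longrightarrow> \<not> big D)" if "j \<le> m" for j
    using that
  proof (induction j)
    case (Suc j)
    from Suc.IH Suc.prems obtain Ps where "\<forall>i<j. Ps i \<subseteq> V - \<Union>(Ps ` {..<i}) \<and> card (Ps i) \<le> k \<and>
      (\<forall>D. conn E D \<longrightarrow> D \<subseteq> V - \<Union>(Ps ` {..i}) - E `` Ps i \<longrightarrow> \<not> big D)" by (auto dest: Suc_leD)
    then have Ps: "\<And>i. i < j \<Longrightarrow> Ps i \<subseteq> V - \<Union>(Ps ` {..<i})" "\<And>i. i < j \<Longrightarrow> card (Ps i) \<le> k"
      and sep: "\<And>i D. i < j \<Longrightarrow> conn E D \<Longrightarrow> D \<subseteq> V - \<Union>(Ps ` {..i}) - E `` Ps i \<Longrightarrow> \<not> big D"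
      by blast+
    define X where "X = \<Union>(Ps ` {..<j})"
    have "X \<subseteq> V" using Ps(1) by (auto simp: X_def)
    have "card X \<le> (\<Sum>i<j. card (Ps i))" unfolding X_def by (rule card_UN_le) simp
    also have "\<dots> \<le> (\<Sum>i<j. k)" by (rule sum_mono) (use Ps(2) in auto)
    also have "\<dots> \<le> k * m" using Suc.prems by simp
    finally have "card X \<le> 3 * k\<^sup>2 * t + M" using m by simp
    then obtain C where C: "conn E C" "C \<subseteq> V - X" "3 * card A < 4 * card (C \<inter> A)"
      using no_sep \<open>X \<subseteq> V\<close> by blast
    have "big C" using C(3) by (simp add: big_def)
    then obtain x where x: "x \<in> C" using big_meet[of C C] by blast
    \<comment> \<open>A full component is taken because every big connected set avoiding
      \<open>X\<close> meets it and thus lies in it. So what separates \<open>C0\<close> separates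
      all of \<open>V - X\<close>.\<close>
    define C0 where "C0 = component E (V - X) x"
    have C0: "C0 \<subseteq> V - X" unfolding C0_def by (rule comp_subset) (use C(2) x in auto)
    have "conn E C0" using \<open>sym E\<close> by (simp add: C0_def conn_comp)
    have "big C0" using big_mono[OF \<open>big C\<close>] conn_subset_comp[OF C(1,2) x] by (simp add: C0_def)
    obtain P where P: "P \<subseteq> C0" "card P \<le> k" "\<And>D. conn E D \<Longrightarrow> D \<subseteq> C0 - P - E `` P \<Longrightarrow> \<not> big D"
      by (rule Gyarfas_path[where big = big, OF \<open>sym E\<close> \<open>irrefl E\<close> \<open>conn E C0\<close> \<open>big C0\<close> big_mono big_meet no_path])
        blast+
    define Qs where "Qs = Ps(j := P)"
    have Qs: "Qs j = P" "\<And>i. i < j \<Longrightarrow> Qs i = Ps i" by (auto simp: Qs_def)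
    have Qs_im: "Qs ` {..<i} = Ps ` {..<i}" if "i \<le> j" for i using that Qs(2) by (intro image_cong) auto
    have Qs_im': "Qs ` {..i} = Ps ` {..i}" if "i < j" for i using that Qs(2) by (intro image_cong) auto
    have P_sep: "\<not> big D" if D: "conn E D" "D \<subseteq> V - \<Union>(Qs ` {..j}) - E `` P" for D
    proof
      assume "big D"
      have "\<Union>(Qs ` {..j}) = P \<union> X"
        using Qs(1) Qs_im[of j] by (simp add: X_def lessThan_Suc_atMost[symmetric] lessThan_Suc)
      then have D': "D \<subseteq> V - X - P - E `` P" using D(2) by blast
      have "D \<inter> C0 \<noteq> {}" using big_meet[OF \<open>big D\<close> \<open>big C0\<close>] .
      moreover have "x \<in> V - X" "D \<subseteq> V - X" using D' x C(2) by auto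
      ultimately have "D \<subseteq> C0"
        unfolding C0_def using component_maximal[OF \<open>sym E\<close> _ D(1)] by simp
      then show False using P(3)[OF D(1)] D' \<open>big D\<close> by blast
    qed
    have P_disj: "P \<subseteq> V - \<Union>(Qs ` {..<j})" using P C0 Qs_im[of j] by (auto simp: X_def)
    have "Qs i \<subseteq> V - \<Union>(Qs ` {..<i}) \<and> card (Qs i) \<le> k \<and>
      (\<forall>D. conn E D \<longrightarrow> D \<subseteq> V - \<Union>(Qs ` {..i}) - E `` Qs i \<longrightarrow> \<not> big D)" if "i < Suc j" for i
    proof (cases "i = j")
      case True
      then show ?thesis using P(2) P_disj P_sep unfolding True Qs(1) by blast
    next
      case False
      then have "i < j" using that by simp
      then show ?thesis
        using Ps(1,2)[of i] sep[of i] Qs(2)[of i] Qs_im[of i] Qs_im'[of i] by simp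
    qed
    then show ?case by blast
  qed simp
  from this[OF order_refl] obtain Ps where "\<forall>i<m. Ps i \<subseteq> V - \<Union>(Ps ` {..<i}) \<and> card (Ps i) \<le> k \<and>
      (\<forall>D. conn E D \<longrightarrow> D \<subseteq> V - \<Union>(Ps ` {..i}) - E `` Ps i \<longrightarrow> \<not> big D)" by blast
  then have Ps: "\<And>i. i < m \<Longrightarrow> Ps i \<subseteq> V - \<Union>(Ps ` {..<i})" "\<And>i. i < m \<Longrightarrow> card (Ps i) \<le> k"
      and sep: "\<And>i D. i < m \<Longrightarrow> conn E D \<Longrightarrow> D \<subseteq> V - \<Union>(Ps ` {..i}) - E `` Ps i \<Longrightarrow> \<not> big D"
    by blast+
  have disj: "Ps i \<inter> Ps j = {}" if "i < m" "j < m" "i \<noteq> j" for i j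
    using that Ps(1)[of i] Ps(1)[of j] by (cases i j rule: linorder_cases) auto
  define Q where "Q = \<Union>(Ps ` {..<m})"
  have "Q \<subseteq> V" using Ps(1) by (auto simp: Q_def)
  have "card Q \<le> (\<Sum>i<m. card (Ps i))" unfolding Q_def by (rule card_UN_le) simp
  also have "\<dots> \<le> (\<Sum>i<m. k)" by (rule sum_mono) (use Ps(2) in auto)
  finally have cardQ: "card Q \<le> 3 * k\<^sup>2 * t" using m by (simp add: mult.commute)
  define W where "W = {z \<in> V - Q. t \<le> card {q \<in> Q. (q, z) \<in> E}}"
  have "W \<subseteq> V" by (auto simp: W_def)
  have finQ: "finite Q" "finite W" using \<open>Q \<subseteq> V\<close> \<open>W \<subseteq> V\<close> \<open>finite V\<close> finite_subset by auto
  have "card W < 2 * (3 * k\<^sup>2) * (w + 1) ^ s"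
  proof (rule few_high_degree_vertices[OF finQ _ \<open>sym E\<close> \<open>irrefl E\<close>])
    show "Q \<inter> W = {}" by (auto simp: W_def)
    show "0 < 3 * k\<^sup>2" using \<open>k > 0\<close> by simp
    show "card K \<le> w" if "K \<subseteq> Q \<union> W" "clique_set E K" for K
      using clique that \<open>Q \<subseteq> V\<close> \<open>W \<subseteq> V\<close> by blast
    show "\<not> induced_biclique E S T" if "S \<subseteq> Q \<union> W" "T \<subseteq> Q \<union> W" "card S = s" "card T = s" for S T
      using biclique that \<open>Q \<subseteq> V\<close> \<open>W \<subseteq> V\<close> by blast
    show "card Q \<le> 3 * k\<^sup>2 * (2 * (2 * (3 * k\<^sup>2) * (w + 1) ^ s) ^ s * (w + 1) ^ s)"
      using cardQ by (simp only: t_def M_def R_def)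
    show "2 * (2 * (3 * k\<^sup>2) * (w + 1) ^ s) ^ s * (w + 1) ^ s \<le> card {q \<in> Q. (q, z) \<in> E}" if "z \<in> W" for z
      using that by (auto simp: W_def t_def M_def R_def)
  qed
  then have "card W < M" by (simp only: M_def R_def)
  then have "card (Q \<union> W) \<le> 3 * k\<^sup>2 * t + M" using card_Un_le[of Q W] cardQ by linarith
  then obtain C where C: "conn E C" "C \<subseteq> V - (Q \<union> W)" "3 * card A < 4 * card (C \<inter> A)"
    using no_sep \<open>Q \<subseteq> V\<close> \<open>W \<subseteq> V\<close> by (metis Un_subset_iff)
  then have "C \<inter> A \<noteq> {}" by auto
  then obtain x where x: "x \<in> C" by auto
  \<comment> \<open>If \<open>x\<close> itself is a neighbour of the path, \<open>component\<close>
    would return \<open>{x}\<close>, which does not avoid the neighbourhood; then nothing counts as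
    near.\<close>
  define near where "near i = (if x \<in> E `` Ps i then {} else component E (C - E `` Ps i) x)" for i
  define U where "U i = {y \<in> C \<inter> A. y \<notin> near i}" for i
  \<comment> \<open>The near part holds at most half of \<open>A\<close>, and \<open>A\<close> has
    fewer than 4/3 as many elements as \<open>C \<inter> A\<close>. So the near part is less than
    2/3 of \<open>C \<inter> A\<close>.\<close>
  have U: "card (C \<inter> A) < 3 * card (U i)" if "i < m" for i
  proof -
    have "conn E (near i)" using \<open>sym E\<close> by (simp add: near_def conn_comp)
    have sub: "near i \<subseteq> C - E `` Ps i" using x comp_subset[of x "C - E `` Ps i" E] by (auto simp: near_def)
    moreover have "\<Union>(Ps ` {..i}) \<subseteq> Q" unfolding Q_def by (intro Union_mono image_mono) (use that in auto)
    ultimately have "\<not> big (near i)" using C(2) by (intro sep[OF that \<open>conn E (near i)\<close>]) blast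
    then have "2 * card (near i \<inter> A) \<le> card A" by (simp add: big_def)
    moreover have "U i = (C \<inter> A) - (near i \<inter> A)" "near i \<inter> A \<subseteq> C \<inter> A" using sub by (auto simp: U_def)
    then have "card (U i) + card (near i \<inter> A) = card (C \<inter> A)"
      using finA by (metis card_Diff_subset card_mono finite_Int finite_subset inf_le2 le_add_diff_inverse2)
    ultimately show ?thesis using C(3) by linarith
  qed
  have "\<exists>y\<in>C \<inter> A. m \<le> 3 * card {i\<in>{..<m}. y \<in> U i}"
  proof (rule ccontr)
    assume "\<not> ?thesis"
    then have less: "3 * card {i\<in>{..<m}. y \<in> U i} \<le> m" if "y \<in> C \<inter> A" for y
      using that by (meson nat_le_linear)
    have "m * card (C \<inter> A) = (\<Sum>i<m. card (C \<inter> A))" by simp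
    also have "\<dots> < (\<Sum>i<m. 3 * card (U i))"
      by (rule sum_strict_mono) (use U \<open>m > 0\<close> in auto)
    also have "\<dots> = 3 * (\<Sum>i<m. card {y \<in> C \<inter> A. y \<in> U i})"
    proof -
      have "{y \<in> C \<inter> A. y \<in> U i} = U i" for i by (auto simp: U_def)
      then show ?thesis by (simp add: sum_distrib_left)
    qed
    also have "\<dots> = (\<Sum>y\<in>C \<inter> A. 3 * card {i\<in>{..<m}. y \<in> U i})"
      using finA by (subst double_count) (auto simp: sum_distrib_left)
    also have "\<dots> \<le> (\<Sum>y\<in>C \<inter> A. m)" by (rule sum_mono) (rule less)
    finally show False by simp
  qed
  then obtain y where y: "y \<in> C" "m \<le> 3 * card {i\<in>{..<m}. y \<in> U i}" by auto
  have "(x, y) \<in> (Restr E C)\<^sup>*" using C(1) x y(1) by (auto simp: conn_def)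
  then obtain f n where f: "f 0 = x" "f n = y" "f ` {..n} \<subseteq> C" "induced_path E f (Suc n)"
    using shortest_induced_path[OF \<open>sym E\<close> \<open>irrefl E\<close> _ x] by metis
  have "Suc n \<le> k"
    using no_path f(4) induced_path_prefix[OF f(4), of k] by (metis not_less_eq_eq nle_le)
  have hit: "\<exists>j\<le>n. f j \<in> E `` Ps i" if "y \<in> U i" for i
  proof (rule ccontr)
    assume "\<not> ?thesis"
    then have sub: "f ` {..n} \<subseteq> C - E `` Ps i" using f(3) by auto
    have "(x, y) \<in> (Restr E (C - E `` Ps i))\<^sup>*"
      using induced_path_walk[OF f(4) sub] f(1,2) relpow_imp_rtrancl by fastforce
    then have "y \<in> component E (C - E `` Ps i) x" by (simp add: component_def)
    moreover have "x \<notin> E `` Ps i" using sub f(1) by auto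
    ultimately show False using that by (simp add: U_def near_def)
  qed
  have few: "card {i\<in>{..<m}. z \<in> E `` Ps i} < t" if "z \<in> C" for z
  proof -
    \<comment> \<open>One neighbour of \<open>z\<close> is chosen on each path that \<open>z\<close>
      sees. The paths are disjoint, so these are distinct vertices of \<open>Q\<close>, fewer than
      \<open>t\<close> because \<open>z \<notin> W\<close>.\<close>
    define q where "q i = (SOME q. q \<in> Ps i \<and> (q, z) \<in> E)" for i
    have q: "q i \<in> Ps i \<and> (q i, z) \<in> E" if "z \<in> E `` Ps i" for i
      unfolding q_def by (rule someI_ex) (use that in auto)
    have "inj_on q {i\<in>{..<m}. z \<in> E `` Ps i}"
    proof (rule inj_onI, rule ccontr)
      fix i j assume *: "i \<in> {i\<in>{..<m}. z \<in> E `` Ps i}" "j \<in> {i\<in>{..<m}. z \<in> E `` Ps i}" "q i = q j" "i \<noteq> j"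
      then have "q i \<in> Ps i" "q j \<in> Ps j" using q[of i] q[of j] by simp_all
      moreover have "Ps i \<inter> Ps j = {}" using disj * by simp
      ultimately show False using \<open>q i = q j\<close> by auto
    qed
    moreover have "q ` {i\<in>{..<m}. z \<in> E `` Ps i} \<subseteq> {q \<in> Q. (q, z) \<in> E}"
      using q by (auto simp: Q_def)
    ultimately have "card {i\<in>{..<m}. z \<in> E `` Ps i} \<le> card {q \<in> Q. (q, z) \<in> E}"
      using finQ(1) by (intro card_inj_on_le) auto
    moreover have "z \<in> V - Q" "z \<notin> W" using that C(2) by auto
    ultimately show ?thesis by (auto simp: W_def)
  qed
  have "card {i\<in>{..<m}. y \<in> U i} \<le> card (\<Union>j\<in>{..n}. {i\<in>{..<m}. f j \<in> E `` Ps i})"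
  proof (rule card_mono)
    show "{i\<in>{..<m}. y \<in> U i} \<subseteq> (\<Union>j\<in>{..n}. {i\<in>{..<m}. f j \<in> E `` Ps i})"
    proof
      fix i assume i: "i \<in> {i\<in>{..<m}. y \<in> U i}"
      then obtain j where "j \<le> n" "f j \<in> E `` Ps i" using hit[of i] by auto
      with i show "i \<in> (\<Union>j\<in>{..n}. {i\<in>{..<m}. f j \<in> E `` Ps i})" by (intro UN_I[of j]) simp_all
    qed
  qed simp
  also have "\<dots> \<le> (\<Sum>j\<le>n. card {i\<in>{..<m}. f j \<in> E `` Ps i})" by (rule card_UN_le) simp
  also have "\<dots> < (\<Sum>j\<le>n. t)" by (rule sum_strict_mono) (use few f(3) in auto)
  also have "\<dots> \<le> k * t" using mult_right_mono[OF \<open>Suc n \<le> k\<close>, of t] by simp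
  finally show False using y(2) by (simp add: m_def)
qed

section \<open>Elimination orders and weak reachability\<close>

definition boundary :: "'a rel \<Rightarrow> 'a set \<Rightarrow> 'a set" where
  "boundary E D = E `` D - D"

text \<open>
  Vertices are inserted from the last to the first one of an elimination order; the boundary of the
  component of \<open>v\<close> consists of the vertices strongly reachable from \<open>v\<close>.
\<close>
inductive eliminable :: "'a rel \<Rightarrow> nat \<Rightarrow> 'a set \<Rightarrow> bool" for E w where
  eliminable_empty: "eliminable E w {}"
| eliminable_insert: "eliminable E w C \<Longrightarrow> v \<notin> C \<Longrightarrow> card (boundary E (component E (insert v C) v)) \<le> w \<Longrightarrow> eliminable E w (insert v C)"

section \<open>Combining and extending elimination orders\<close>

lemma component_closed:
  "z \<in> component E X x \<Longrightarrow> x \<in> X \<Longrightarrow> y \<in> X \<Longrightarrow> (z, y) \<in> E \<Longrightarrow> y \<in> component E X x"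
  using comp_subset[of x X E] by (auto simp: component_def intro: rtrancl.rtrancl_into_rtrancl)

lemma component_Un:
  assumes "x \<in> C" "C \<times> D \<inter> E = {}"
  shows "component E (C \<union> D) x = component E C x"
proof
  show "component E C x \<subseteq> component E (C \<union> D) x"
    unfolding component_def by (intro Image_mono rtrancl_mono) auto
  show "component E (C \<union> D) x \<subseteq> component E C x"
  proof
    fix y assume "y \<in> component E (C \<union> D) x"
    then have "(x, y) \<in> (Restr E (C \<union> D))\<^sup>*" by (simp add: component_def)
    then show "y \<in> component E C x"
    proof induction
      case base show ?case by (rule comp_self)
    next
      case (step y z)
      then have "y \<in> C" using comp_subset[OF assms(1), of E] by blast
      with step assms(2) have "z \<in> C" by blast
      with step show ?case using assms(1) by (auto intro: component_closed)
    qed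
  qed
qed

text \<open>Without edges from \<open>C\<close> to \<open>D\<close>, a vertex of \<open>C\<close>
  has the same component with and without \<open>D\<close>, so all of \<open>C\<close> can be
  inserted after \<open>D\<close>.\<close>

lemma eliminable_Un:
  assumes "eliminable E w C" "eliminable E w D" "C \<inter> D = {}" "C \<times> D \<inter> E = {}"
  shows "eliminable E w (C \<union> D)"
  using assms
proof induction
  case (eliminable_insert C v)
  have "component E (insert v C \<union> D) v = component E (insert v C) v"
    by (rule component_Un) (use eliminable_insert.prems in auto)
  moreover have "eliminable E w (C \<union> D)" using eliminable_insert by blast
  ultimately have "eliminable E w (insert v (C \<union> D))"
    using eliminable_insert.hyps eliminable_insert.prems by (intro eliminable.eliminable_insert) auto
  then show ?case by simp
qed simp

text \<open>\<open>X\<close> may be inserted in any order: a boundary vertex of the new component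
  cannot lie in \<open>C\<close>, where it would be absorbed, so it lies in \<open>X\<close> or in
  the boundary of \<open>X \<union> C\<close>.\<close>

lemma eliminable_extend:
  assumes "finite X" "eliminable E w C" "X \<inter> C = {}" "finite (boundary E (X \<union> C))"
    "card (boundary E (X \<union> C)) + card X \<le> w"
  shows "eliminable E w (X \<union> C)"
proof -
  have "Y \<subseteq> X \<Longrightarrow> eliminable E w (Y \<union> C)" if "finite Y" for Y
    using that
  proof induction
    case (insert v Y)
    define D where "D = component E (insert v (Y \<union> C)) v"
    have D: "D \<subseteq> insert v (Y \<union> C)" unfolding D_def by (rule comp_subset) auto
    have "boundary E D \<subseteq> boundary E (X \<union> C) \<union> X"
    proof
      fix y assume "y \<in> boundary E D"
      then obtain z where z: "z \<in> D" "(z, y) \<in> E" "y \<notin> D" by (auto simp: boundary_def)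
      have "y \<notin> C" using z component_closed[of z E "insert v (Y \<union> C)" v y] by (auto simp: D_def)
      moreover have "z \<in> X \<union> C" using z D insert.prems by auto
      ultimately show "y \<in> boundary E (X \<union> C) \<union> X" using z by (auto simp: boundary_def)
    qed
    then have "card (boundary E D) \<le> card (boundary E (X \<union> C) \<union> X)"
      using assms(1,4) by (intro card_mono) auto
    also have "\<dots> \<le> w" using card_Un_le assms(5) le_trans by blast
    finally have "eliminable E w (insert v (Y \<union> C))"
      using insert assms(3) by (intro eliminable_insert) (auto simp: D_def)
    then show ?case by simp
  qed (use assms in simp)
  then show ?thesis using assms(1) by simp
qed

lemma conn_add_neighbours:
  assumes "sym E" "conn E D" "finite N" "N \<subseteq> E `` D"
  shows "conn E (D \<union> N)"
  using assms(3,4)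
proof induction
  case (insert u N)
  then obtain x where "x \<in> D" "(x, u) \<in> E" by auto
  then have "conn E (insert u (D \<union> N))"
    using insert assms(1) by (intro conn_insert[of E _ x]) auto
  then show ?case by simp
qed (use assms in simp)

text \<open>
  The usual recursion for tree decompositions: separate the boundary of a component in a balanced way,
  which keeps the boundaries of the new components below \<open>4 (h + 1)\<close>.
\<close>
lemma eliminable_if_balanced_separators:
  assumes "finite V" "E \<subseteq> V \<times> V" "sym E"
    and sep: "\<And>A. A \<subseteq> V \<Longrightarrow> \<exists>X\<subseteq>V. card X \<le> h \<and>
      (\<forall>C. conn E C \<longrightarrow> C \<subseteq> V - X \<longrightarrow> 4 * card (C \<inter> A) \<le> 3 * card A)"
  shows "eliminable E (5 * (h + 1)) V"
proof -
  have fin: "finite (boundary E D)" "boundary E D \<subseteq> V" for D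
    using assms(1,2) by (auto simp: boundary_def intro: finite_subset[of _ V])
  \<comment> \<open>Deleting a separator may disconnect the set, so the hypothesis speaks of every
    component of \<open>C\<close>. The 5 splits into \<open>4 * (h + 1)\<close> boundary vertices
    and \<open>h + 1\<close> inserted ones.\<close>
  have "eliminable E (5 * (h + 1)) C"
    if "C \<subseteq> V" "\<And>x. x \<in> C \<Longrightarrow> card (boundary E (component E C x)) \<le> 4 * (h + 1)" for C
    using that
  proof (induction "card C" arbitrary: C rule: less_induct)
    case less
    have "finite C" using less.prems(1) assms(1) finite_subset by blast
    show ?case
    proof (cases "C = {}")
      case True then show ?thesis by (simp add: eliminable_empty)
    next
      case False
      then obtain x where x: "x \<in> C" by auto
      define D where "D = component E C x"
      have D: "D \<subseteq> C" "x \<in> D" "conn E D"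
        using comp_subset[OF x] comp_self[of x E C] conn_comp[OF assms(3)] by (auto simp: D_def)
      have closed: "z \<in> D" if "y \<in> D" "z \<in> C" "(y, z) \<in> E" for y z
        using component_closed that x by (simp add: D_def)
      show ?thesis
      proof (cases "D = C")
        case False
        have "eliminable E (5 * (h + 1)) D"
        proof (rule less.hyps)
          show "card D < card C" using False D(1) \<open>finite C\<close> by (simp add: psubset_card_mono psubsetI)
          show "D \<subseteq> V" using D less.prems by auto
          show "card (boundary E (component E D y)) \<le> 4 * (h + 1)" if "y \<in> D" for y
          proof -
            have "component E D y = D"
              using conn_subset_comp[OF D(3) order_refl that] comp_subset[OF that, of E] by auto
            then show ?thesis using less.prems(2)[OF x] by (simp add: D_def)
          qed
        qed
        moreover have "eliminable E (5 * (h + 1)) (C - D)"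
        proof (rule less.hyps)
          have "card (C - D) < card C" using D x \<open>finite C\<close> by (intro psubset_card_mono) auto
          then show "card (C - D) < card C" .
          show "C - D \<subseteq> V" using less.prems by auto
          show "card (boundary E (component E (C - D) y)) \<le> 4 * (h + 1)" if "y \<in> C - D" for y
          proof -
            have "component E (C - D \<union> D) y = component E (C - D) y"
              by (rule component_Un) (use that closed assms(3) in \<open>auto simp: sym_def\<close>)
            moreover have "C - D \<union> D = C" using D by auto
            ultimately show ?thesis using less.prems(2)[of y] that by simp
          qed
        qed
        moreover have "D \<times> (C - D) \<inter> E = {}" using closed by auto
        ultimately have "eliminable E (5 * (h + 1)) (D \<union> (C - D))" by (intro eliminable_Un) auto
        moreover have "D \<union> (C - D) = C" using D by auto
        ultimately show ?thesis by simp
      next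
        case True
        define S where "S = boundary E C"
        have S: "S \<subseteq> V" "card S \<le> 4 * (h + 1)"
          using fin[of C] less.prems(2)[OF x] True by (auto simp: S_def D_def)
        obtain X where X: "X \<subseteq> V" "card X \<le> h"
          "\<And>K. conn E K \<Longrightarrow> K \<subseteq> V - X \<Longrightarrow> 4 * card (K \<inter> S) \<le> 3 * card S"
          using sep[OF S(1)] by blast
        have "finite X" using X(1) assms(1) finite_subset by blast
        \<comment> \<open>Adding \<open>x\<close> makes the set smaller for the recursion even if
          \<open>X\<close> misses \<open>C\<close>.\<close>
        define X' where "X' = insert x (X \<inter> C)"
        have X': "finite X'" "X' \<subseteq> C" "card X' \<le> h + 1"
        proof -
          have "card X' \<le> Suc (card (X \<inter> C))" unfolding X'_def by (rule card_insert_le_m1) auto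
          moreover have "card (X \<inter> C) \<le> card X" using \<open>finite X\<close> by (intro card_mono) auto
          ultimately show "card X' \<le> h + 1" using X(2) by linarith
        qed (use x \<open>finite X\<close> in \<open>auto simp: X'_def\<close>)
        have "eliminable E (5 * (h + 1)) (C - X')"
        proof (rule less.hyps)
          show "card (C - X') < card C"
            using x \<open>finite C\<close> by (intro psubset_card_mono) (auto simp: X'_def)
          show "C - X' \<subseteq> V" using less.prems by auto
          show "card (boundary E (component E (C - X') y)) \<le> 4 * (h + 1)" if y: "y \<in> C - X'" for y
          proof -
            define D' where "D' = component E (C - X') y"
            have D': "D' \<subseteq> C - X'" "conn E D'"
              using comp_subset[OF y] conn_comp[OF assms(3)] by (auto simp: D'_def)
            \<comment> \<open>The balance condition counts vertices of \<open>S\<close> inside a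
              connected set, but the neighbours of \<open>D'\<close> in \<open>S\<close> lie outside
              \<open>D'\<close>. Those not in \<open>X\<close> are therefore attached to it.\<close>
            define K where "K = D' \<union> (boundary E D' \<inter> S - X)"
            have "conn E K"
              unfolding K_def using assms(3) D'(2) fin(1)[of D'] by (intro conn_add_neighbours) (auto simp: boundary_def)
            have "K \<subseteq> V - X" using D'(1) less.prems(1) S(1) by (auto simp: K_def X'_def)
            with \<open>conn E K\<close> have KS: "4 * card (K \<inter> S) \<le> 3 * card S" by (rule X(3))
            have "boundary E D' \<subseteq> insert x ((K \<inter> S) \<union> X)"
            proof
              fix z assume z: "z \<in> boundary E D'"
              then obtain d where d: "d \<in> D'" "(d, z) \<in> E" "z \<notin> D'" by (auto simp: boundary_def)
              show "z \<in> insert x ((K \<inter> S) \<union> X)"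
              proof (cases "z \<in> C")
                case True
                then have "z \<in> X'" using d component_closed[of d E "C - X'" y z] y by (auto simp: D'_def)
                then show ?thesis by (auto simp: X'_def)
              next
                case False
                then have "z \<in> S" using d D'(1) by (auto simp: S_def boundary_def)
                then show ?thesis using z by (auto simp: K_def)
              qed
            qed
            then have "card (boundary E D') \<le> card (insert x ((K \<inter> S) \<union> X))"
              using \<open>finite X\<close> fin(1)[of C] by (intro card_mono) (auto simp: S_def)
            also have "\<dots> \<le> Suc (card ((K \<inter> S) \<union> X))" by (rule card_insert_le_m1) auto
            also have "\<dots> \<le> Suc (card (K \<inter> S) + card X)" by (simp add: card_Un_le)
            finally have "card (boundary E D') \<le> Suc (card (K \<inter> S) + card X)" .
            \<comment> \<open>This is 3/4 of \<open>4 * (h + 1)\<close>. Together with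
              \<open>h\<close> for \<open>X\<close> and 1 for \<open>x\<close> it is
              \<open>4 * (h + 1)\<close> again, which explains the 4.\<close>
            moreover have "card (K \<inter> S) \<le> 3 * (h + 1)" using KS S(2) by presburger
            ultimately have "card (boundary E D') \<le> Suc (3 * (h + 1) + h)" using X(2)
              by (meson Suc_le_mono add_mono le_trans)
            then show ?thesis by (simp add: D'_def)
          qed
        qed
        moreover have C: "X' \<union> (C - X') = C" using X' by auto
        ultimately have "eliminable E (5 * (h + 1)) (X' \<union> (C - X'))"
          using X' S(2) fin(1)[of C] by (intro eliminable_extend) (auto simp: C S_def)
        then show ?thesis unfolding C .
      qed
    qed
  qed
  moreover have "boundary E (component E V x) = {}" if "x \<in> V" for x
  proof -
    have "y \<in> component E V x" if "z \<in> component E V x" "(z, y) \<in> E" for y z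
      by (rule component_closed[OF that(1) \<open>x \<in> V\<close> _ that(2)]) (use assms(2) that(2) in auto)
    then show ?thesis by (auto simp: boundary_def)
  qed
  ultimately show ?thesis by simp
qed

text \<open>The vertex inserted last gets the least rank, so the vertices of rank at least
  \<open>r v\<close> are those present once \<open>v\<close> has been inserted.\<close>

lemma eliminable_rank:
  assumes "eliminable E w C"
  shows "\<exists>r :: 'a \<Rightarrow> nat. inj_on r C \<and> (\<forall>v\<in>C. card (boundary E (component E {u \<in> C. r v \<le> r u} v)) \<le> w)"
  using assms
proof induction
  case (eliminable_insert C v)
  then obtain r :: "'a \<Rightarrow> nat" where r: "inj_on r C" "\<forall>v\<in>C. card (boundary E (component E {u \<in> C. r v \<le> r u} v)) \<le> w"
    by auto
  define r' where "r' u = (if u = v then 0 else Suc (r u))" for u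
  have "inj_on r' (insert v C)" using r(1) eliminable_insert(2) by (auto simp: inj_on_def r'_def)
  moreover have "{u \<in> insert v C. r' v \<le> r' u} = insert v C" by (auto simp: r'_def)
  moreover have "{u \<in> insert v C. r' y \<le> r' u} = {u \<in> C. r y \<le> r u}" if "y \<in> C" for y
    using that eliminable_insert(2) by (auto simp: r'_def)
  ultimately show ?case using eliminable_insert r(2) by (intro exI[of _ r']) auto
qed simp

text \<open>\<open>anc v\<close> plays the role of the set of ancestors of \<open>v\<close>, including \<open>v\<close>, in a rooted forest.\<close>
definition tree_order :: "'a rel \<Rightarrow> 'a set \<Rightarrow> ('a \<Rightarrow> 'a set) \<Rightarrow> bool" where
  "tree_order E V anc \<longleftrightarrow>
     (\<forall>v\<in>V. v \<in> anc v \<and> anc v \<subseteq> V) \<and>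
     (\<forall>v\<in>V. \<forall>u\<in>anc v. anc u \<subseteq> anc v \<and> (v \<in> anc u \<longrightarrow> u = v)) \<and>
     (\<forall>v\<in>V. \<forall>u\<in>anc v. \<forall>w\<in>anc v. u \<in> anc w \<or> w \<in> anc u) \<and>
     (\<forall>u\<in>V. \<forall>v\<in>V. (u, v) \<in> E \<longrightarrow> u \<in> anc v \<or> v \<in> anc u)"

lemma tree_orderD:
  assumes "tree_order E V anc"
  shows "v \<in> V \<Longrightarrow> v \<in> anc v" "v \<in> V \<Longrightarrow> anc v \<subseteq> V"
    "v \<in> V \<Longrightarrow> u \<in> anc v \<Longrightarrow> anc u \<subseteq> anc v"
    "v \<in> V \<Longrightarrow> u \<in> anc v \<Longrightarrow> v \<in> anc u \<Longrightarrow> u = v"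
    "v \<in> V \<Longrightarrow> u \<in> anc v \<Longrightarrow> w \<in> anc v \<Longrightarrow> u \<in> anc w \<or> w \<in> anc u"
    "u \<in> V \<Longrightarrow> v \<in> V \<Longrightarrow> (u, v) \<in> E \<Longrightarrow> u \<in> anc v \<or> v \<in> anc u"
  using assms unfolding tree_order_def by blast+

text \<open>The weakly reachable set without a length bound: \<open>u\<close> has the least rank on
  some walk from \<open>v\<close> to \<open>u\<close>.\<close>

definition wreach :: "'a rel \<Rightarrow> 'a set \<Rightarrow> ('a \<Rightarrow> nat) \<Rightarrow> 'a \<Rightarrow> 'a set" where
  "wreach E V r v = {u \<in> V. (v, u) \<in> (Restr E {z \<in> V. r u \<le> r z})\<^sup>*}"

section \<open>Weak reachability and its size\<close>

lemma wreach_rank: "u \<in> wreach E V r v \<Longrightarrow> r u \<le> r v"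
  by (auto simp: wreach_def elim: converse_rtranclE)

lemma wreach_trans:
  fixes r :: "'a \<Rightarrow> nat"
  assumes "(v, u) \<in> (Restr E {z \<in> V. r u \<le> r z})\<^sup>*" "(u, w) \<in> (Restr E {z \<in> V. r w \<le> r z})\<^sup>*" "r w \<le> r u"
  shows "(v, w) \<in> (Restr E {z \<in> V. r w \<le> r z})\<^sup>*"
proof -
  have "Restr E {z \<in> V. r u \<le> r z} \<subseteq> Restr E {z \<in> V. r w \<le> r z}" using assms(3) by auto
  then have "(v, u) \<in> (Restr E {z \<in> V. r w \<le> r z})\<^sup>*" using assms(1) rtrancl_mono by blast
  then show ?thesis using assms(2) by (rule rtrancl_trans)
qed

text \<open>Two vertices weakly reachable from \<open>v\<close> are comparable because their walks
  can be joined at \<open>v\<close>, and the joined walk stays above the smaller of the two ranks.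
  Of two adjacent vertices, the one of smaller rank is reached in one step.\<close>

lemma tree_order_wreach:
  assumes "sym E" "inj_on r V"
  shows "tree_order E V (wreach E V r)"
  unfolding tree_order_def
proof (intro conjI ballI impI)
  show "v \<in> wreach E V r v" "wreach E V r v \<subseteq> V" if "v \<in> V" for v
    using that by (auto simp: wreach_def)
  fix v u assume v: "v \<in> V" and u: "u \<in> wreach E V r v"
  show "wreach E V r u \<subseteq> wreach E V r v"
  proof
    fix w assume w: "w \<in> wreach E V r u"
    show "w \<in> wreach E V r v"
      using wreach_trans[of v u E V r w] wreach_rank[OF w] u w by (simp add: wreach_def)
  qed
  show "u = v" if "v \<in> wreach E V r u"
    using wreach_rank[OF u] wreach_rank[OF that] assms(2) u v by (auto simp: wreach_def inj_on_def)
  have step: "w \<in> wreach E V r u"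
    if "u \<in> wreach E V r v" "w \<in> wreach E V r v" "r w \<le> r u" for u w
  proof -
    have "sym ((Restr E {z \<in> V. r u \<le> r z})\<^sup>*)" using assms(1) by (intro sym_rtrancl) (auto simp: sym_def)
    then have "(u, v) \<in> (Restr E {z \<in> V. r u \<le> r z})\<^sup>*" using that(1) by (auto simp: wreach_def dest: symD)
    moreover have "Restr E {z \<in> V. r u \<le> r z} \<subseteq> Restr E {z \<in> V. r w \<le> r z}" using that(3) by auto
    ultimately have "(u, v) \<in> (Restr E {z \<in> V. r w \<le> r z})\<^sup>*" using rtrancl_mono by blast
    then show ?thesis using that(2) by (auto simp: wreach_def intro: rtrancl_trans)
  qed
  fix w assume "w \<in> wreach E V r v"
  then show "u \<in> wreach E V r w \<or> w \<in> wreach E V r u" using step u nat_le_linear by blast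
next
  fix u v assume uv: "u \<in> V" "v \<in> V" "(u, v) \<in> E"
  have "(v, u) \<in> E" using uv assms(1) by (auto dest: symD)
  show "u \<in> wreach E V r v \<or> v \<in> wreach E V r u"
  proof (cases "r u \<le> r v")
    case True
    then have "(v, u) \<in> Restr E {z \<in> V. r u \<le> r z}" using uv \<open>(v, u) \<in> E\<close> by auto
    then show ?thesis using uv by (auto simp: wreach_def)
  next
    case False
    then have "(u, v) \<in> Restr E {z \<in> V. r v \<le> r z}" using uv by auto
    then show ?thesis using uv by (auto simp: wreach_def)
  qed
qed

text \<open>\<open>b\<close> is the first vertex of the walk outside \<open>K\<close>; the strictly
  shorter rest of the walk drives the next induction.\<close>

lemma relpow_exit:
  assumes "(a, u) \<in> R ^^ n" "a \<in> K" "u \<notin> K" "R \<subseteq> E"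
  shows "\<exists>b\<in>boundary E K. \<exists>m<n. (b, u) \<in> R ^^ m"
  using assms
proof (induction n arbitrary: a)
  case (Suc n)
  then obtain c where c: "(a, c) \<in> R" "(c, u) \<in> R ^^ n" by (meson relpow_Suc_D2)
  show ?case
  proof (cases "c \<in> K")
    case True
    then show ?thesis using Suc.IH[OF c(2)] Suc.prems less_Suc_eq by blast
  next
    case False
    then have "c \<in> boundary E K" using c Suc.prems by (auto simp: boundary_def)
    then show ?thesis using c by blast
  qed
qed auto

text \<open>Let \<open>K\<close> be the component of \<open>v\<close> among the vertices of rank at
  least \<open>r v\<close>. A target in \<open>K\<close> can only be \<open>v\<close> itself; any
  other walk leaves \<open>K\<close> through one of at most \<open>w\<close> boundary vertices and
  then has at most \<open>n\<close> steps left.\<close>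

lemma card_bounded_wreach:
  fixes r :: "'a \<Rightarrow> nat"
  assumes "finite V" "E \<subseteq> V \<times> V" "inj_on r V"
    and w: "\<And>v. v \<in> V \<Longrightarrow> card (boundary E (component E {u \<in> V. r v \<le> r u} v)) \<le> w"
    and "v \<in> V"
  shows "card {u \<in> V. \<exists>m\<le>n. (v, u) \<in> (Restr E {z \<in> V. r u \<le> r z}) ^^ m} \<le> (w + 1) ^ n"
  using assms(5)
proof (induction n arbitrary: v)
  case 0
  have "{u \<in> V. \<exists>m\<le>0. (v, u) \<in> (Restr E {z \<in> V. r u \<le> r z}) ^^ m} \<subseteq> {v}" by auto
  then show ?case using card_mono[of "{v}"] by fastforce
next
  case (Suc n)
  define R where "R n v = {u \<in> V. \<exists>m\<le>n. (v, u) \<in> (Restr E {z \<in> V. r u \<le> r z}) ^^ m}" for n v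
  define K where "K = component E {u \<in> V. r v \<le> r u} v"
  have K: "K \<subseteq> {u \<in> V. r v \<le> r u}" "v \<in> K"
    unfolding K_def using comp_subset[of v "{u \<in> V. r v \<le> r u}" E] Suc.prems by (auto simp: comp_self)
  have boundaryV: "boundary E K \<subseteq> V" using assms(2) by (auto simp: boundary_def)
  then have fin: "finite (boundary E K)" using assms(1) finite_subset by blast
  have "R (Suc n) v \<subseteq> insert v (\<Union>b\<in>boundary E K. R n b)"
  proof
    fix u assume "u \<in> R (Suc n) v"
    then obtain m where u: "u \<in> V" "m \<le> Suc n" "(v, u) \<in> (Restr E {z \<in> V. r u \<le> r z}) ^^ m"
      by (auto simp: R_def)
    show "u \<in> insert v (\<Union>b\<in>boundary E K. R n b)"
    proof (cases "u \<in> K")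
      case True
      have "u \<in> wreach E V r v" using u relpow_imp_rtrancl by (fastforce simp: wreach_def)
      then have "r u = r v" using wreach_rank True K(1) by fastforce
      then show ?thesis using assms(3) u(1) Suc.prems by (auto simp: inj_on_def)
    next
      case False
      obtain b m' where "b \<in> boundary E K" "m' < m" "(b, u) \<in> (Restr E {z \<in> V. r u \<le> r z}) ^^ m'"
        using relpow_exit[OF u(3) K(2) False, of E] by auto
      then have "u \<in> R n b" using u by (auto simp: R_def intro!: exI[of _ m'])
      then show ?thesis using \<open>b \<in> boundary E K\<close> by blast
    qed
  qed
  moreover have finR: "finite (R n b)" for n b using assms(1) by (simp add: R_def)
  ultimately have "card (R (Suc n) v) \<le> card (insert v (\<Union>b\<in>boundary E K. R n b))"
    using fin by (intro card_mono) auto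
  also have "\<dots> \<le> Suc (card (\<Union>b\<in>boundary E K. R n b))" by (rule card_insert_le_m1) auto
  also have "\<dots> \<le> Suc (\<Sum>b\<in>boundary E K. card (R n b))" using card_UN_le[OF fin] by simp
  also have "\<dots> \<le> Suc (\<Sum>b\<in>boundary E K. (w + 1) ^ n)"
    using Suc.IH boundaryV by (intro Suc_le_mono[THEN iffD2] sum_mono) (auto simp: R_def)
  also have "\<dots> \<le> Suc (w * (w + 1) ^ n)" using w[OF Suc.prems] by (simp add: K_def)
  also have "\<dots> \<le> (w + 1) ^ Suc n" using one_le_power[of "w + 1" n] by simp
  finally show ?case by (simp add: R_def)
qed

text \<open>Without long induced paths, shortest paths are short, so that weak reachability is bounded in length.\<close>
lemma wreach_bounded:
  assumes "sym E" "irrefl E" "\<And>f. \<not> induced_path E f k" "v \<in> V"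
  shows "wreach E V r v \<subseteq> {u \<in> V. \<exists>m\<le>k. (v, u) \<in> (Restr E {z \<in> V. r u \<le> r z}) ^^ m}"
proof
  fix u assume u: "u \<in> wreach E V r v"
  have reach: "(v, u) \<in> (Restr E {z \<in> V. r u \<le> r z})\<^sup>*" and v: "v \<in> {z \<in> V. r u \<le> r z}"
    using assms(4) u wreach_rank[OF u] by (auto simp: wreach_def)
  obtain f n where f: "f 0 = v" "f n = u" "f ` {..n} \<subseteq> {z \<in> V. r u \<le> r z}" "induced_path E f (Suc n)"
    using shortest_induced_path[OF assms(1,2) reach v] .
  have "Suc n \<le> k"
    using assms(3) f(4) induced_path_prefix[OF f(4), of k] by (metis not_less_eq_eq nle_le)
  then show "u \<in> {u \<in> V. \<exists>m\<le>k. (v, u) \<in> (Restr E {z \<in> V. r u \<le> r z}) ^^ m}"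
    using induced_path_walk[OF f(4,3)] f(1,2) u by (auto simp: wreach_def intro!: exI[of _ n])
qed

text \<open>With \<open>h = 3 * k\<^sup>2 * t + M\<close> as the separator size,
  \<open>5 * (h + 1)\<close> bounds the strongly reachable vertices, and the exponent
  \<open>k\<close> bounds the length of the walks.\<close>

lemma tree_order_of_path_biclique_free:
  fixes k w s :: nat
  defines "R \<equiv> (w + 1) ^ s"
  defines "M \<equiv> 2 * (3 * k\<^sup>2) * R"
  defines "t \<equiv> 2 * M ^ s * R"
  assumes "finite V" "E \<subseteq> V \<times> V" "sym E" "irrefl E"
    and "\<And>f. \<not> induced_path E f k"
    and "\<And>K. K \<subseteq> V \<Longrightarrow> clique_set E K \<Longrightarrow> card K \<le> w"
    and "\<And>S T. S \<subseteq> V \<Longrightarrow> T \<subseteq> V \<Longrightarrow> card S = s \<Longrightarrow> card T = s \<Longrightarrow> \<not> induced_biclique E S T"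
  shows "\<exists>anc. tree_order E V anc \<and>
    (\<forall>v\<in>V. card (anc v) \<le> (5 * (3 * k\<^sup>2 * t + M + 1) + 1) ^ k)"
proof -
  have "eliminable E (5 * (3 * k\<^sup>2 * t + M + 1)) V"
  proof (rule eliminable_if_balanced_separators[OF assms(4-6)])
    fix A assume "A \<subseteq> V"
    obtain X where "X \<subseteq> V" "card X \<le> 3 * k\<^sup>2 * t + M"
      "\<And>C. conn E C \<Longrightarrow> C \<subseteq> V - X \<Longrightarrow> 4 * card (C \<inter> A) \<le> 3 * card A"
      unfolding R_def M_def t_def
      by (rule balanced_separator[OF assms(4,6-8) _ _ \<open>A \<subseteq> V\<close>, where w = w and s = s])
        (use assms(9,10) in blast)+
    then show "\<exists>X\<subseteq>V. card X \<le> 3 * k\<^sup>2 * t + M \<and>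
      (\<forall>C. conn E C \<longrightarrow> C \<subseteq> V - X \<longrightarrow> 4 * card (C \<inter> A) \<le> 3 * card A)"
      by blast
  qed
  then obtain r :: "'a \<Rightarrow> nat" where r: "inj_on r V"
    "\<forall>v\<in>V. card (boundary E (component E {u \<in> V. r v \<le> r u} v)) \<le> 5 * (3 * k\<^sup>2 * t + M + 1)"
    using eliminable_rank by blast
  have "card (wreach E V r v) \<le> (5 * (3 * k\<^sup>2 * t + M + 1) + 1) ^ k" if "v \<in> V" for v
  proof -
    have "card (wreach E V r v) \<le> card {u \<in> V. \<exists>m\<le>k. (v, u) \<in> (Restr E {z \<in> V. r u \<le> r z}) ^^ m}"
      using wreach_bounded[OF assms(6-8) that] assms(4) by (intro card_mono) auto
    also have "\<dots> \<le> (5 * (3 * k\<^sup>2 * t + M + 1) + 1) ^ k"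
      using r by (intro card_bounded_wreach[OF assms(4,5) r(1) _ that]) auto
    finally show ?thesis .
  qed
  then show ?thesis using tree_order_wreach[OF assms(6) r(1)] by blast
qed

section \<open>Treedepth decompositions from tree orders\<close>

lemma finite_arg_max:
  fixes f :: "'b \<Rightarrow> nat"
  assumes "finite A" "A \<noteq> {}"
  obtains a where "a \<in> A" "\<And>b. b \<in> A \<Longrightarrow> f b \<le> f a"
proof -
  have "Max (f ` A) \<in> f ` A" using assms by (intro Max_in) auto
  then obtain a where "a \<in> A" "f a = Max (f ` A)" by auto
  then show thesis using assms by (intro that[of a]) auto
qed

section \<open>Paths and graphs in elementary terms\<close>

lemma vpath_with_proj_iff:
  "vpath p (with_proj F) \<longleftrightarrow>
    p \<noteq> [] \<and> set p \<subseteq> pverts F \<and> successively (\<lambda>x y. (x, y) \<in> parcs F) p \<and> distinct p"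
proof -
  have "set (vwalk_arcs p) \<subseteq> parcs F \<longleftrightarrow> successively (\<lambda>x y. (x, y) \<in> parcs F) p"
    by (induction p rule: vwalk_arcs.induct) auto
  then show ?thesis by (auto simp: vpath_def vwalk_def)
qed

lemma pair_graph_iff:
  "pair_graph F \<longleftrightarrow> finite (pverts F) \<and> parcs F \<subseteq> pverts F \<times> pverts F \<and> sym (parcs F) \<and> irrefl (parcs F)"
proof
  assume "pair_graph F"
  then interpret pair_graph F .
  have "sym (parcs F)" using pair_sym_arcs by (simp add: symmetric_def)
  then show "finite (pverts F) \<and> parcs F \<subseteq> pverts F \<times> pverts F \<and> sym (parcs F) \<and> irrefl (parcs F)"
    using pair_finite_verts pair_no_loops by (fastforce dest: wellformed' simp: irrefl_def)
next
  assume *: "finite (pverts F) \<and> parcs F \<subseteq> pverts F \<times> pverts F \<and> sym (parcs F) \<and> irrefl (parcs F)"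
  then have "finite (parcs F)" using finite_subset by blast
  with * show "pair_graph F"
    by unfold_locales (auto simp: symmetric_def irrefl_def)
qed

lemma root_path_iff:
  "root_path F R p v \<longleftrightarrow> p \<noteq> [] \<and> set p \<subseteq> pverts F \<and> successively (\<lambda>x y. (x, y) \<in> parcs F) p \<and>
     distinct p \<and> hd p \<in> R \<and> last p = v"
  by (auto simp: root_path_def vpath_with_proj_iff)

lemma finite_root_path_lengths:
  assumes "finite (pverts F)"
  shows "finite {length p | p v. root_path F R p v \<and> leaf F R v}"
proof (rule finite_subset)
  show "{length p | p v. root_path F R p v \<and> leaf F R v} \<subseteq> {..card (pverts F)}"
    using assms by (auto simp: root_path_iff) (metis card_mono distinct_card)
qed simp

text \<open>The arcs of \<open>F\<close> join each vertex to its parent, whose ancestors are those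
  of the vertex without the vertex itself; the non-membership conditions exclude loops. Roots are
  the vertices without proper ancestors.\<close>

context
  fixes E V anc and F R
  assumes finV: "finite V" and order: "tree_order E V anc"
  defines "F \<equiv> \<lparr>pverts = V, parcs = {(u, v). u \<in> V \<and> v \<in> V \<and>
     (v \<notin> anc u \<and> anc v = insert v (anc u) \<or> u \<notin> anc v \<and> anc u = insert u (anc v))}\<rparr>"
    and "R \<equiv> {v \<in> V. anc v = {v}}"
begin

lemmas order_simps = tree_orderD[OF order]

lemma finite_anc: "v \<in> V \<Longrightarrow> finite (anc v)"
  using order_simps(2) finV finite_subset by blast

text \<open>The parent is a proper ancestor with the most ancestors: a proper ancestor outside
  \<open>anc u\<close> would be comparable to \<open>u\<close>, hence lie below it and have
  more.\<close>

lemma parent_ex: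
  assumes "v \<in> V" "anc v \<noteq> {v}"
  obtains u where "u \<in> V" "v \<notin> anc u" "anc v = insert v (anc u)"
proof -
  let ?A = "anc v - {v}"
  have A: "finite ?A" "?A \<noteq> {}" using assms order_simps(1)[of v] finite_anc by auto
  obtain u where u: "u \<in> anc v" "u \<noteq> v" and max: "\<And>w. w \<in> ?A \<Longrightarrow> card (anc w) \<le> card (anc u)"
    using finite_arg_max[OF A, of "\<lambda>u. card (anc u)"] by blast
  have uV: "u \<in> V" using u order_simps(2) assms by auto
  have v: "v \<notin> anc u" using u order_simps(4) assms by auto
  have "w \<in> anc u" if w: "w \<in> ?A" for w
  proof (rule ccontr)
    assume "w \<notin> anc u"
    have wV: "w \<in> V" using w order_simps(2) assms by auto
    have "u \<in> anc w" using order_simps(5)[of v u w] w u \<open>w \<notin> anc u\<close> assms by auto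
    then have "anc u \<subseteq> anc w" using order_simps(3) wV by auto
    moreover have "w \<in> anc w" using order_simps(1) wV by auto
    ultimately have "anc u \<subset> anc w" using \<open>w \<notin> anc u\<close> by auto
    then have "card (anc u) < card (anc w)" using finite_anc wV by (simp add: psubset_card_mono)
    with max[OF w] show False by simp
  qed
  then have "anc v = insert v (anc u)"
    using order_simps(1)[of v] order_simps(3)[of v u] assms u by auto
  with uV v show thesis by (rule that)
qed

lemma F_simps: "pverts F = V" "(u, v) \<in> parcs F \<longleftrightarrow> u \<in> V \<and> v \<in> V \<and>
     (v \<notin> anc u \<and> anc v = insert v (anc u) \<or> u \<notin> anc v \<and> anc u = insert u (anc v))"
  by (auto simp: F_def)

lemma pair_graph_F: "pair_graph F"
  unfolding pair_graph_iff using finV order_simps(1) by (auto simp: F_def sym_def irrefl_def)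

lemma root_path_ex:
  assumes "v \<in> V"
  shows "\<exists>p. root_path F R p v \<and> set p = anc v"
  using assms
proof (induction "card (anc v)" arbitrary: v rule: less_induct)
  case less
  show ?case
  proof (cases "anc v = {v}")
    case True
    then show ?thesis
      using less.prems by (intro exI[of _ "[v]"]) (auto simp: root_path_iff R_def F_simps)
  next
    case False
    then obtain u where u: "u \<in> V" "v \<notin> anc u" "anc v = insert v (anc u)"
      using parent_ex less.prems by metis
    then obtain p where p: "root_path F R p u" "set p = anc u"
      using less.hyps[of u] finite_anc by auto
    then have "root_path F R (p @ [v]) v"
      using u less.prems by (auto simp: root_path_iff successively_append_iff F_simps)
    then show ?thesis using p u by (intro exI[of _ "p @ [v]"]) auto
  qed
qed

text \<open>A path from a root only descends: a step up would lead to an ancestor of the current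
  vertex, and all of these are already on the path.\<close>

lemma root_path_set:
  assumes "root_path F R p v"
  shows "set p = anc v"
proof -
  have "p \<noteq> [] \<longrightarrow> set p \<subseteq> V \<longrightarrow> successively (\<lambda>x y. (x, y) \<in> parcs F) p \<longrightarrow> distinct p \<longrightarrow> hd p \<in> R \<longrightarrow>
    set p = anc (last p)"
  proof (induction p rule: rev_induct)
    case (snoc w p)
    show ?case
    proof (intro impI)
      assume *: "set (p @ [w]) \<subseteq> V" "successively (\<lambda>x y. (x, y) \<in> parcs F) (p @ [w])"
        "distinct (p @ [w])" "hd (p @ [w]) \<in> R"
      show "set (p @ [w]) = anc (last (p @ [w]))"
      proof (cases "p = []")
        case True then show ?thesis using * by (auto simp: R_def)
      next
        case False
        then have p: "set p = anc (last p)" "(last p, w) \<in> parcs F" "w \<notin> set p"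
          using snoc * by (auto simp: successively_append_iff)
        have "w \<in> V" using * by auto
        from p(2) have "anc w = insert w (anc (last p))"
        proof (unfold F_simps, elim conjE disjE)
          assume "anc (last p) = insert (last p) (anc w)"
          then show ?thesis using p(1,3) order_simps(1)[OF \<open>w \<in> V\<close>] by auto
        qed
        then show ?thesis using p by auto
      qed
    qed
  qed simp
  then show ?thesis using assms by (auto simp: root_path_iff F_simps)
qed

text \<open>On a cycle, a vertex with the most ancestors has two distinct neighbours, both of which
  must be its parent; but the parent is unique.\<close>

lemma acyclic_F: "acyclic_graph F"
  unfolding acyclic_graph_def vpath_with_proj_iff
proof safe
  fix p
  assume p: "length p \<ge> 3" "(last p, hd p) \<in> parcs F" "set p \<subseteq> pverts F" "distinct p"
    "successively (\<lambda>x y. (x, y) \<in> parcs F) p"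
  define n where "n = length p"
  have arc: "(p ! i, p ! Suc i) \<in> parcs F" if "Suc i < n" for i
    using p(5) that by (auto simp: successively_conv_nth n_def)
  have "p \<noteq> []" using p(1) by fastforce
  then have arc': "(p ! (n - 1), p ! 0) \<in> parcs F"
    using p(2) by (simp add: n_def last_conv_nth hd_conv_nth)
  have symF: "(y, x) \<in> parcs F" if "(x, y) \<in> parcs F" for x y using that by (auto simp: F_simps)
  have "{..<n} \<noteq> {}" using \<open>p \<noteq> []\<close> by (simp add: n_def lessThan_empty_iff)
  then obtain i where i: "i < n" and max: "\<And>j. j < n \<Longrightarrow> card (anc (p ! j)) \<le> card (anc (p ! i))"
    using finite_arg_max[of "{..<n}" "\<lambda>i. card (anc (p ! i))"] by auto
  have down: "p ! i \<notin> anc (p ! j) \<and> anc (p ! i) = insert (p ! i) (anc (p ! j))"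
    if "j < n" "(p ! j, p ! i) \<in> parcs F" for j
  proof (rule ccontr)
    assume no: "\<not> ?thesis"
    have V: "p ! i \<in> V" "p ! j \<in> V" using that(2) by (auto simp: F_simps)
    from no that(2) have "p ! j \<notin> anc (p ! i)" "anc (p ! j) = insert (p ! j) (anc (p ! i))"
      by (auto simp: F_simps)
    then have "card (anc (p ! i)) < card (anc (p ! j))" using finite_anc[OF V(1)] by simp
    with max[OF that(1)] show False by simp
  qed
  obtain a b where ab: "a < n" "b < n" "a \<noteq> b" "(p ! a, p ! i) \<in> parcs F" "(p ! b, p ! i) \<in> parcs F"
  proof -
    \<comment> \<open>Indices are cyclic; \<open>length p \<ge> 3\<close> keeps the two neighbours
      apart.\<close>
    consider "i = 0" | "i = n - 1" "i > 0" | "i > 0" "Suc i < n" using i by linarith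
    then show thesis
    proof cases
      case 1 then show thesis using that[of 1 "n - 1"] arc[of 0] arc' symF p(1) by (simp add: n_def)
    next
      case 2
      have "3 \<le> n" using p(1) by (simp add: n_def)
      then have "Suc (n - 2) = n - 1" "Suc (n - 2) < n" by linarith+
      then have "(p ! (n - 2), p ! i) \<in> parcs F" using arc[of "n - 2"] 2 by simp
      then show thesis using that[of 0 "n - 2"] arc' symF 2 \<open>3 \<le> n\<close> by simp
    next
      case 3 then show thesis using that[of "i - 1" "Suc i"] arc[of "i - 1"] arc[of i] symF by simp
    qed
  qed
  have V: "p ! a \<in> V" "p ! b \<in> V" using ab by (auto simp: F_simps)
  have "anc (p ! a) = anc (p ! b)" using down[OF ab(1,4)] down[OF ab(2,5)] by (metis insert_ident)
  then have "p ! a = p ! b" using order_simps(1)[OF V(1)] order_simps(1)[OF V(2)] order_simps(4)[OF V(1), of "p ! b"] by auto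
  then show False using ab(1-3) p(4) by (simp add: n_def nth_eq_iff_index_eq)
qed

text \<open>Every root that reaches \<open>v\<close> belongs to \<open>anc v\<close>. Two such roots
  are comparable, and a root has no ancestor but itself.\<close>

lemma rooted_forest_F: "rooted_forest F R"
  unfolding rooted_forest_def
proof (intro conjI ballI)
  interpret pair_graph F by (rule pair_graph_F)
  show "R \<subseteq> pverts F" by (auto simp: R_def F_simps)
  fix v assume v: "v \<in> pverts F"
  then obtain p where p: "root_path F R p v" "set p = anc v" using root_path_ex by (auto simp: F_simps)
  then have 1: "hd p \<in> R" "hd p \<rightarrow>\<^sup>*\<^bsub>F\<^esub> v"
    unfolding root_path_def reachable_vpath_conv by auto
  have 2: "set q = anc v \<and> hd q = r" if "r \<in> R" "vpath q F" "hd q = r" "last q = v" for q r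
    using root_path_set[of q v] that by (auto simp: root_path_def)
  show "\<exists>!r. r \<in> R \<and> r \<rightarrow>\<^sup>*\<^bsub>F\<^esub> v"
  proof (rule ex1I[of _ "hd p"])
    fix r assume r: "r \<in> R \<and> r \<rightarrow>\<^sup>*\<^bsub>F\<^esub> v"
    then obtain q where q: "vpath q F" "hd q = r" "last q = v" by (auto simp: reachable_vpath_conv)
    then have "r \<in> anc v" using 2[OF _ q] r q(1) by (auto simp: vpath_with_proj_iff)
    moreover have "hd p \<in> anc v" using p by (auto simp: root_path_iff)
    ultimately show "r = hd p" using order_simps(5)[of v r "hd p"] v r 1 by (auto simp: R_def F_simps)
  qed (use 1 in simp)
qed (rule pair_graph_F, rule acyclic_F)

lemma ancestor_F: "v \<in> V \<Longrightarrow> ancestor F R u v \<longleftrightarrow> u \<in> anc v"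
  unfolding ancestor_def using root_path_ex[of v] root_path_set[of _ v] by blast

lemma depth_F:
  assumes "\<And>v. v \<in> V \<Longrightarrow> card (anc v) \<le> d"
  shows "depth F R \<le> d"
proof -
  have "length p \<le> d" if "root_path F R p v" for p v
  proof -
    have "v \<in> V" using that last_in_set by (fastforce simp: root_path_iff F_simps)
    moreover have "length p = card (anc v)"
      using that root_path_set[OF that] distinct_card by (fastforce simp: root_path_iff)
    ultimately show ?thesis using assms by simp
  qed
  then show ?thesis
    unfolding depth_def using finite_root_path_lengths[of F R] finV by (auto simp: F_simps)
qed

lemma treedepth_decomposition_F:
  assumes "pair_graph G" "pverts G = V" "parcs G = E"
  shows "treedepth_decomposition G F R"
proof -
  have G: "E \<subseteq> V \<times> V" "irrefl E" using assms by (auto simp: pair_graph_iff)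
  have "subgraph (with_proj G) (with_proj (transitive_closure F R))"
    unfolding subgraph_def
  proof (intro conjI)
    show "verts G \<subseteq> verts (transitive_closure F R)"
      using assms by (simp add: transitive_closure_def F_simps)
    show "arcs G \<subseteq> arcs (transitive_closure F R)"
    proof
      fix e assume "e \<in> arcs G"
      then obtain u v where e: "e = (u, v)" "(u, v) \<in> E" using assms by (cases e) auto
      then have "u \<in> V" "v \<in> V" "u \<noteq> v" using G by (auto simp: irrefl_def)
      then show "e \<in> arcs (transitive_closure F R)"
        using e order_simps(6)[of u v] ancestor_F[of u v] ancestor_F[of v u]
        by (simp add: transitive_closure_def)
    qed
    show "wf_digraph (transitive_closure F R)"
      by unfold_locales
        (auto simp: transitive_closure_def ancestor_def root_path_iff)
    interpret pair_graph G by fact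
    show "wf_digraph G" by unfold_locales
    show "compatible (transitive_closure F R) G" by (simp add: compatible_def)
  qed
  then show ?thesis
    using rooted_forest_F assms by (simp add: treedepth_decomposition_def F_simps)
qed

end

lemma treedepth_decomposition_of_tree_order:
  assumes "pair_graph G" "tree_order (parcs G) (pverts G) anc" "\<And>v. v \<in> pverts G \<Longrightarrow> card (anc v) \<le> d"
  shows "\<exists>F R. treedepth_decomposition G F R \<and> depth F R \<le> d"
  using treedepth_decomposition_F[OF _ assms(2) assms(1) refl refl] depth_F[OF _ assms(2,3)] assms(1)
  unfolding pair_graph_iff by blast

section \<open>Tree orders from treedepth decompositions\<close>

text \<open>If the paths split right after \<open>a\<close>, follow the first up to its first vertex
  \<open>x\<close> on the second and return along the second. This is a cycle of length at least 3,
  since different second vertices leave \<open>p1\<close> or \<open>q1\<close> nonempty.\<close>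

lemma acyclic_graph_unique_vpath:
  assumes "sym (parcs F)" "acyclic_graph F" "vpath p (with_proj F)" "vpath q (with_proj F)"
    "hd p = hd q" "last p = last q"
  shows "p = q"
  using assms(3-6)
proof (induction p arbitrary: q)
  case Nil
  then show ?case by (simp add: vpath_with_proj_iff)
next
  case (Cons a p)
  let ?P = "\<lambda>x y. (x, y) \<in> parcs F"
  from Cons.prems obtain q' where q: "q = a # q'" by (cases q) (auto simp: vpath_with_proj_iff)
  show ?case
  proof (cases "p = [] \<or> q' = []")
    case True
    then show ?thesis
      using Cons.prems q by (auto simp: vpath_with_proj_iff dest: last_in_set split: if_splits)
  next
    case False
    then have ne: "p \<noteq> []" "q' \<noteq> []" by auto
    have p: "vpath p (with_proj F)" "(a, hd p) \<in> parcs F" "a \<notin> set p" "a \<in> pverts F"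
      and q': "vpath q' (with_proj F)" "(a, hd q') \<in> parcs F" "a \<notin> set q'"
      and last: "last p = last q'"
      using Cons.prems ne q by (auto simp: vpath_with_proj_iff successively_Cons)
    show ?thesis
    proof (cases "hd p = hd q'")
      case True
      then show ?thesis using Cons.IH[OF p(1) q'(1) _ last] q by simp
    next
      case False
      have "\<exists>x\<in>set p. x \<in> set q'" using ne last last_in_set by metis
      then obtain p1 x p2 where p12: "p = p1 @ x # p2" "x \<in> set q'" "\<forall>y\<in>set p1. y \<notin> set q'"
        using split_list_first_prop[of p "\<lambda>x. x \<in> set q'"] by metis
      obtain q1 q2 where q12: "q' = q1 @ x # q2" using split_list[OF p12(2)] by metis
      define c where "c = a # p1 @ x # rev q1"
      have "p1 \<noteq> [] \<or> q1 \<noteq> []" using False p12(1) q12 by auto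
      then have "length c \<ge> 3" by (cases p1; cases q1) (auto simp: c_def)
      have rev: "successively ?P (rev xs)" if "successively ?P xs" for xs
        using that assms(1) unfolding successively_rev
        by (rule_tac successively_mono[of ?P]) (auto dest: symD)
      have p1x: "successively ?P (a # p1 @ [x])"
        using Cons.prems(1) p12(1)
        by (auto simp: vpath_with_proj_iff successively_append_iff successively_Cons hd_append)
      have "successively ?P (q1 @ [x])"
        using q'(1) q12 by (auto simp: vpath_with_proj_iff successively_append_iff successively_Cons)
      then have "successively ?P (x # rev q1)" using rev[of "q1 @ [x]"] by simp
      with p1x have "successively ?P c"
        by (auto simp: c_def successively_append_iff successively_Cons hd_append)
      moreover have "distinct c"
        using p q' p12 q12 by (auto simp: c_def vpath_with_proj_iff)
      moreover have "set c \<subseteq> pverts F"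
        using p q' p12 q12 by (auto simp: c_def vpath_with_proj_iff)
      ultimately have "vpath c (with_proj F)" by (simp add: vpath_with_proj_iff c_def)
      moreover have "last c = hd q'" using q12 by (cases q1) (auto simp: c_def)
      then have "(last c, hd c) \<in> parcs F" using q'(2) assms(1) by (auto simp: c_def dest: symD)
      ultimately show ?thesis using assms(2) \<open>length c \<ge> 3\<close> unfolding acyclic_graph_def by blast
    qed
  qed
qed

text \<open>The ancestors of \<open>v\<close> are the vertices of its unique root path
  \<open>rp v\<close>. Root paths are closed under prefixes, and two prefixes of one list are
  comparable.\<close>

lemma tree_order_of_treedepth_decomposition:
  assumes "treedepth_decomposition G F R"
  shows "tree_order (parcs G) (pverts G) (\<lambda>v. {u. ancestor F R u v})"
    and "v \<in> pverts G \<Longrightarrow> card {u. ancestor F R u v} \<le> depth F R"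
proof -
  have forest: "rooted_forest F R" and V: "pverts F = pverts G"
    and sub: "parcs G \<subseteq> parcs (transitive_closure F R)"
    using assms by (auto simp: treedepth_decomposition_def subgraph_def)
  have "pair_graph F" using forest by (simp add: rooted_forest_def)
  then interpret pair_graph F .
  have F: "finite (pverts F)" "sym (parcs F)"
    using \<open>pair_graph F\<close> by (auto simp: pair_graph_iff)
  have unique: "p = q" if "root_path F R p v" "root_path F R q v" for p q v
  proof (rule acyclic_graph_unique_vpath)
    have "hd p \<in> R" "hd p \<rightarrow>\<^sup>*\<^bsub>F\<^esub> v" "hd q \<in> R" "hd q \<rightarrow>\<^sup>*\<^bsub>F\<^esub> v"
      using that by (auto simp: root_path_def reachable_vpath_conv)
    moreover have "v \<in> pverts F" using that(1) last_in_set by (fastforce simp: root_path_iff)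
    ultimately show "hd p = hd q" using forest unfolding rooted_forest_def by blast
  qed (use that forest F in \<open>auto simp: root_path_def rooted_forest_def\<close>)
  define rp where "rp v = (SOME p. root_path F R p v)" for v
  have rp: "root_path F R (rp v) v" if "v \<in> pverts G" for v
  proof -
    have "\<exists>!r. r \<in> R \<and> r \<rightarrow>\<^sup>*\<^bsub>F\<^esub> v" using forest that V by (simp add: rooted_forest_def)
    then obtain r where "r \<in> R" "r \<rightarrow>\<^sup>*\<^bsub>F\<^esub> v" by (elim ex1E) blast
    then have "\<exists>p. root_path F R p v" by (auto simp: root_path_def reachable_vpath_conv)
    then show ?thesis unfolding rp_def by (rule someI_ex)
  qed
  have anc: "{u. ancestor F R u v} = set (rp v)" if "v \<in> pverts G" for v
    using rp[OF that] unique[of _ v] by (auto simp: ancestor_def)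
  have rp_set: "set (rp v) \<subseteq> pverts G" "v \<in> set (rp v)" "last (rp v) = v" "distinct (rp v)"
    if "v \<in> pverts G" for v
    using rp[OF that] last_in_set[of "rp v"] V by (auto simp: root_path_iff)
  have prefix: "\<exists>ys. rp v = rp u @ ys" if vG: "v \<in> pverts G" and u: "u \<in> set (rp v)" for u v
  proof -
    obtain xs ys where xs: "rp v = xs @ u # ys" using split_list[OF u] by metis
    have "root_path F R (xs @ [u]) u"
      using rp[OF vG] unfolding xs root_path_iff
      by (cases xs) (auto simp: successively_append_iff successively_Cons hd_append)
    moreover have "u \<in> pverts G" using rp_set(1)[OF vG] u by auto
    ultimately have "rp u = xs @ [u]" using unique rp by blast
    then show ?thesis using xs by simp
  qed
  show "tree_order (parcs G) (pverts G) (\<lambda>v. {u. ancestor F R u v})"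
    unfolding tree_order_def
  proof (intro conjI ballI impI)
    fix v assume v: "v \<in> pverts G"
    show "v \<in> {u. ancestor F R u v}" "{u. ancestor F R u v} \<subseteq> pverts G"
      unfolding anc[OF v] using rp_set[OF v] by auto
    fix u assume "u \<in> {u. ancestor F R u v}"
    then have u: "u \<in> set (rp v)" using anc[OF v] by auto
    then have uG: "u \<in> pverts G" using rp_set[OF v] by auto
    obtain ys where ys: "rp v = rp u @ ys" using prefix[OF v u] by auto
    show "{w. ancestor F R w u} \<subseteq> {u. ancestor F R u v}"
      unfolding anc[OF v] anc[OF uG] using ys by auto
    show "u = v" if "v \<in> {w. ancestor F R w u}"
    proof -
      have "v \<in> set (rp u)" using that anc[OF uG] by auto
      then obtain zs where "rp u = rp v @ zs" using prefix[OF uG] by auto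
      then have "rp u = rp v" using ys by simp
      then have "last (rp u) = last (rp v)" by (rule arg_cong)
      then show ?thesis unfolding rp_set(3)[OF uG] rp_set(3)[OF v] .
    qed
    fix w assume "w \<in> {u. ancestor F R u v}"
    then have w: "w \<in> set (rp v)" using anc[OF v] by auto
    then have wG: "w \<in> pverts G" using rp_set[OF v] by auto
    obtain zs where "rp v = rp w @ zs" using prefix[OF v w] by auto
    then have "rp u @ ys = rp w @ zs" using ys by simp
    then obtain us where "rp u = rp w @ us \<or> rp w = rp u @ us"
      unfolding append_eq_append_conv2 by metis
    then have "set (rp u) \<subseteq> set (rp w) \<or> set (rp w) \<subseteq> set (rp u)" by (metis set_append Un_upper1)
    then show "u \<in> {u. ancestor F R u w} \<or> w \<in> {w. ancestor F R w u}"
      unfolding anc[OF uG] anc[OF wG] using rp_set(2)[OF uG] rp_set(2)[OF wG] by blast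
  next
    fix u v assume "(u, v) \<in> parcs G"
    then show "u \<in> {u. ancestor F R u v} \<or> v \<in> {w. ancestor F R w u}"
      using sub by (auto simp: transitive_closure_def)
  qed
  show "card {u. ancestor F R u v} \<le> depth F R" if v: "v \<in> pverts G"
  proof -
    \<comment> \<open>\<open>depth\<close> measures only paths ending in a leaf. A longest root path
      through \<open>v\<close> is one of them, and \<open>rp v\<close> is a prefix of it.\<close>
    define D where "D = {w \<in> pverts G. v \<in> set (rp w)}"
    have D: "finite D" "D \<noteq> {}" using F(1) V v rp_set(2)[OF v] by (auto simp: D_def)
    obtain w where w: "w \<in> D" and max: "\<And>w'. w' \<in> D \<Longrightarrow> length (rp w') \<le> length (rp w)"
      using finite_arg_max[OF D, of "\<lambda>w. length (rp w)"] by blast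
    have wG: "w \<in> pverts G" and vw: "v \<in> set (rp w)" using w by (auto simp: D_def)
    have "leaf F R w"
      unfolding leaf_def
    proof (intro conjI allI impI)
      show "w \<in> pverts F" using wG V by simp
      fix w' assume a: "ancestor F R w w'"
      then have w'G: "w' \<in> pverts G" using V last_in_set by (fastforce simp: ancestor_def root_path_iff)
      then have "w \<in> set (rp w')" using a anc[OF w'G] by auto
      then obtain zs where zs: "rp w' = rp w @ zs" using prefix[OF w'G] by auto
      then have "w' \<in> D" using w'G vw by (auto simp: D_def)
      then have "zs = []" using max[of w'] zs by simp
      then have "last (rp w') = last (rp w)" using zs by simp
      then show "w' = w" unfolding rp_set(3)[OF w'G] rp_set(3)[OF wG] .
    qed
    then have "length (rp w) \<in> insert 0 {length p | p v. root_path F R p v \<and> leaf F R v}"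
      using rp[OF wG] by blast
    then have "length (rp w) \<le> depth F R"
      unfolding depth_def using finite_root_path_lengths[OF F(1), of R] by (intro Max_ge) auto
    moreover obtain zs where "rp w = rp v @ zs" using prefix[OF wG vw] by auto
    ultimately show ?thesis using distinct_card[OF rp_set(4)[OF v]] anc[OF v] by simp
  qed
qed

section \<open>Treedepth expressed by tree orders\<close>

lemma treedepth_le:
  assumes "pair_graph G" "tree_order (parcs G) (pverts G) anc" "\<And>v. v \<in> pverts G \<Longrightarrow> card (anc v) \<le> d"
  shows "treedepth G \<le> d"
proof -
  obtain F R where FR: "treedepth_decomposition G F R" "depth F R \<le> d"
    using treedepth_decomposition_of_tree_order[OF assms] by auto
  then have "treedepth G \<le> depth F R" unfolding treedepth_def by (intro Least_le) auto
  with FR show ?thesis by simp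
qed

text \<open>The \<open>LEAST\<close> in \<open>treedepth\<close> has a meaning only if some
  decomposition exists; weak reachability for an arbitrary injective ranking provides one.\<close>

lemma treedepth_tree_order:
  assumes "pair_graph G"
  obtains anc where "tree_order (parcs G) (pverts G) anc" "\<And>v. v \<in> pverts G \<Longrightarrow> card (anc v) \<le> treedepth G"
proof -
  have G: "finite (pverts G)" "sym (parcs G)" using assms by (auto simp: pair_graph_iff)
  obtain r :: "'a \<Rightarrow> nat" where r: "inj_on r (pverts G)"
    using finite_imp_inj_to_nat_seg[OF G(1)] by blast
  have "card (wreach (parcs G) (pverts G) r v) \<le> card (pverts G)" for v
    by (rule card_mono) (auto simp: G wreach_def)
  then have "\<exists>F R. treedepth_decomposition G F R \<and> depth F R \<le> card (pverts G)"
    using treedepth_decomposition_of_tree_order[OF assms tree_order_wreach[OF G(2) r]] by blast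
  then have "\<exists>d F R. treedepth_decomposition G F R \<and> depth F R = d" by blast
  then have "\<exists>F R. treedepth_decomposition G F R \<and> depth F R = treedepth G"
    unfolding treedepth_def by (rule LeastI_ex)
  then obtain F R where FR: "treedepth_decomposition G F R" "depth F R = treedepth G" by blast
  show thesis
    using tree_order_of_treedepth_decomposition(1)[OF FR(1)]
      tree_order_of_treedepth_decomposition(2)[OF FR(1)]
    unfolding FR(2) by (rule that)
qed

section \<open>Paths and bicliques have large treedepth\<close>

text \<open>The new vertex is comparable to the head of the tail, hence to the common ancestor of
  the tail; whichever of the two is the ancestor serves for all.\<close>

lemma tree_order_common_ancestor:
  assumes "tree_order E V anc" "successively (\<lambda>x y. (x, y) \<in> E) xs" "set xs \<subseteq> V" "xs \<noteq> []"
  shows "\<exists>x\<in>set xs. \<forall>y\<in>set xs. x \<in> anc y"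
  using assms(2-4)
proof (induction xs)
  case (Cons y ys)
  note ord = tree_orderD[OF assms(1)]
  show ?case
  proof (cases "ys = []")
    case True then show ?thesis using ord(1) Cons.prems by auto
  next
    case False
    then obtain x where x: "x \<in> set ys" "\<And>z. z \<in> set ys \<Longrightarrow> x \<in> anc z"
      using Cons by (auto simp: successively_Cons)
    have V: "y \<in> V" "hd ys \<in> V" "x \<in> V" "set ys \<subseteq> V" using Cons.prems False x by auto
    have "y \<in> anc (hd ys) \<or> hd ys \<in> anc y"
      using ord(6)[OF V(1,2)] Cons.prems False by (auto simp: successively_Cons)
    then have "x \<in> anc y \<or> y \<in> anc x"
      using ord(5)[OF V(2), of x y] ord(3)[OF V(1), of "hd ys"] x(2)[of "hd ys"] False by auto
    then show ?thesis
    proof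
      assume "x \<in> anc y" then show ?thesis using x by auto
    next
      assume "y \<in> anc x"
      then have "y \<in> anc z" if "z \<in> set ys" for z using ord(3)[of z x] x(2)[OF that] that V by auto
      then show ?thesis using ord(1) V by auto
    qed
  qed
qed simp

text \<open>Deleting the common ancestor splits the path into two pieces whose vertices have one
  ancestor less. Ancestors are counted on the path only, so that the induction hypothesis applies to
  the pieces.\<close>

lemma tree_order_path_bound:
  assumes "tree_order E V anc"
    and "successively (\<lambda>x y. (x, y) \<in> E) xs" "set xs \<subseteq> V" "distinct xs"
    and "\<And>y. y \<in> set xs \<Longrightarrow> card (anc y \<inter> set xs) \<le> d"
  shows "length xs < 2 ^ d"
  using assms(2-5)
proof (induction d arbitrary: xs)
  case 0
  have "xs = []"
  proof (rule ccontr)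
    assume "xs \<noteq> []"
    then have "hd xs \<in> anc (hd xs) \<inter> set xs"
      using "0.prems"(2) tree_orderD(1)[OF assms(1), of "hd xs"] hd_in_set by blast
    moreover have "card (anc (hd xs) \<inter> set xs) = 0" using "0.prems"(4)[of "hd xs"] \<open>xs \<noteq> []\<close> by simp
    ultimately show False by (auto simp: card_eq_0_iff)
  qed
  then show ?case by simp
next
  case (Suc d)
  show ?case
  proof (cases "xs = []")
    case False
    obtain x where x: "x \<in> set xs" "\<And>y. y \<in> set xs \<Longrightarrow> x \<in> anc y"
      using tree_order_common_ancestor[OF assms(1) Suc.prems(1,2) False] by auto
    obtain as bs where xs: "xs = as @ x # bs" using split_list[OF x(1)] by metis
    have smaller: "length ys < 2 ^ d"
      if "successively (\<lambda>x y. (x, y) \<in> E) ys" "set ys \<subseteq> set xs" "distinct ys" "x \<notin> set ys" for ys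
    proof (rule Suc.IH)
      show "set ys \<subseteq> V" using that Suc.prems by auto
      fix y assume y: "y \<in> set ys"
      then have "anc y \<inter> set ys \<subset> anc y \<inter> set xs" using that x by auto
      then have "card (anc y \<inter> set ys) < card (anc y \<inter> set xs)" by (intro psubset_card_mono) auto
      also have "\<dots> \<le> Suc d" using Suc.prems(4) y that(2) by auto
      finally show "card (anc y \<inter> set ys) \<le> d" by simp
    qed (use that in auto)
    have "length as < 2 ^ d" "length bs < 2 ^ d"
      using Suc.prems(1,3) unfolding xs
      by (auto intro!: smaller simp: xs successively_append_iff successively_Cons)
    then show ?thesis using xs by simp
  qed simp
qed

text \<open>If \<open>S\<close> contains two incomparable vertices, every common neighbour must lie
  above them, so \<open>T\<close> consists of ancestors of one vertex. Otherwise \<open>S\<close> is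
  a chain and consists of ancestors of its lowest vertex.\<close>

lemma tree_order_biclique_bound:
  assumes "tree_order E V anc" "finite V" "S \<subseteq> V" "T \<subseteq> V" "S \<times> T \<subseteq> E"
    and "\<And>v. v \<in> V \<Longrightarrow> card (anc v) \<le> d" "card S = s" "card T = s"
  shows "s \<le> d"
proof (cases "s = 0")
  case False
  note ord = tree_orderD[OF assms(1)]
  have fin: "finite (anc v)" if "v \<in> V" for v using ord(2)[OF that] assms(2) finite_subset by blast
  show ?thesis
  proof (cases "\<exists>a\<in>S. \<exists>a'\<in>S. a \<notin> anc a' \<and> a' \<notin> anc a")
    case True
    then obtain a a' where a: "a \<in> S" "a' \<in> S" "a \<notin> anc a'" "a' \<notin> anc a" by auto
    have aV: "a \<in> V" "a' \<in> V" using a assms(3) by auto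
    have "T \<subseteq> anc a"
    proof
      fix b assume b: "b \<in> T"
      then have bV: "b \<in> V" and E: "(a, b) \<in> E" "(a', b) \<in> E" using a assms(4,5) by auto
      show "b \<in> anc a"
      proof (rule ccontr)
        assume "b \<notin> anc a"
        then have ab: "a \<in> anc b" using ord(6)[OF aV(1) bV E(1)] by auto
        have "a' \<notin> anc b" using ord(5)[OF bV ab, of a'] a by auto
        then have "b \<in> anc a'" using ord(6)[OF aV(2) bV E(2)] by auto
        then show False using ord(3)[OF aV(2), of b] ab a by auto
      qed
    qed
    then have "card T \<le> card (anc a)" using fin aV by (intro card_mono) auto
    then show ?thesis using assms(6)[OF aV(1)] assms(8) by simp
  next
    case False
    have finS: "finite S" "S \<noteq> {}" using assms(2,3,7) \<open>s \<noteq> 0\<close> finite_subset by auto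
    obtain a where a: "a \<in> S" and max: "\<And>b. b \<in> S \<Longrightarrow> card (anc b) \<le> card (anc a)"
      using finite_arg_max[OF finS, of "\<lambda>a. card (anc a)"] by blast
    have aV: "a \<in> V" using a assms(3) by auto
    have "S \<subseteq> anc a"
    proof
      fix b assume b: "b \<in> S"
      have bV: "b \<in> V" using b assms(3) by auto
      show "b \<in> anc a"
      proof (rule ccontr)
        assume no: "b \<notin> anc a"
        then have "a \<in> anc b" using False a b by auto
        then have "anc a \<subset> anc b" using ord(3)[OF bV] ord(1)[OF bV] no by auto
        then have "card (anc a) < card (anc b)" using fin[OF bV] by (intro psubset_card_mono)
        with max[OF b] show False by simp
      qed
    qed
    then have "card S \<le> card (anc a)" using fin aV by (intro card_mono) auto
    then show ?thesis using assms(6)[OF aV] assms(7) by simp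
  qed
qed simp

section \<open>Hereditary classes\<close>

definition induced :: "'a pair_pre_digraph \<Rightarrow> 'a set \<Rightarrow> 'a pair_pre_digraph" where
  "induced G S = \<lparr>pverts = S, parcs = Restr (parcs G) S\<rparr>"

lemma pair_graph_induced:
  "pair_graph G \<Longrightarrow> S \<subseteq> pverts G \<Longrightarrow> pair_graph (induced G S)"
  by (auto simp: pair_graph_iff induced_def sym_def irrefl_def intro: finite_subset)

lemma hereditary_induced:
  assumes "graph_class \<G>" "hereditary \<G>" "G \<in> \<G>" "S \<subseteq> pverts G"
  shows "induced G S \<in> \<G>"
proof -
  have G: "pair_graph G" using assms by (auto simp: graph_class_def)
  have "X \<subseteq> pverts G \<Longrightarrow> induced G (pverts G - X) \<in> \<G>" if "finite X" for X
    using that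
  proof induction
    case empty
    have "induced G (pverts G) = G" using G by (cases G) (auto simp: induced_def pair_graph_iff)
    then show ?case using assms by simp
  next
    case (insert v X)
    then have "v \<in> pverts (induced G (pverts G - X))" by (auto simp: induced_def)
    then have "del_vertex (induced G (pverts G - X)) v \<in> \<G>"
      using insert assms(2) by (auto simp: hereditary_def)
    moreover have "del_vertex (induced G (pverts G - X)) v = induced G (pverts G - insert v X)"
      by (auto simp: del_vertex_def induced_def)
    ultimately show ?case by simp
  qed
  from this[of "pverts G - S"] have "induced G (pverts G - (pverts G - S)) \<in> \<G>"
    using G by (auto simp: pair_graph_iff)
  moreover have "pverts G - (pverts G - S) = S" using assms(4) by auto
  ultimately show ?thesis by simp
qed

section \<open>Clique numbers of paths and bicliques\<close>

lemma clique_iff: "clique G K \<longleftrightarrow> K \<subseteq> pverts G \<and> clique_set (parcs G) K"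
  by (simp add: clique_def clique_set_def)

lemma
  assumes "finite (pverts G)"
  shows card_le_clique_number: "clique G K \<Longrightarrow> card K \<le> clique_number G"
    and clique_number_le: "(\<And>K. clique G K \<Longrightarrow> card K \<le> n) \<Longrightarrow> clique_number G \<le> n"
proof -
  have "{card K | K. clique G K} \<subseteq> {..card (pverts G)}"
    using assms by (auto simp: clique_def intro: card_mono)
  then have fin: "finite {card K | K. clique G K}" by (rule finite_subset) simp
  show "clique G K \<Longrightarrow> card K \<le> clique_number G"
    unfolding clique_number_def using fin by (intro Max_ge) auto
  have "clique G {}" by (simp add: clique_def)
  then have "{card K | K. clique G K} \<noteq> {}" by auto
  then show "(\<And>K. clique G K \<Longrightarrow> card K \<le> n) \<Longrightarrow> clique_number G \<le> n"
    unfolding clique_number_def using fin by (intro Max.boundedI) auto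
qed

lemma card_le_2I:
  assumes "\<And>x y z. x \<in> K \<Longrightarrow> y \<in> K \<Longrightarrow> z \<in> K \<Longrightarrow> x \<noteq> y \<Longrightarrow> y \<noteq> z \<Longrightarrow> x \<noteq> z \<Longrightarrow> False"
  shows "card K \<le> 2"
proof (rule ccontr)
  assume "\<not> card K \<le> 2"
  then have "3 \<le> card K" by simp
  then obtain B where "B \<subseteq> K" "card B = 3" by (meson obtain_subset_with_card_n)
  then obtain x y z where "x \<in> K" "y \<in> K" "z \<in> K" "x \<noteq> y" "y \<noteq> z" "x \<noteq> z"
    by (auto simp: card_3_iff)
  then show False by (rule assms)
qed

lemma induced_path_clique_number:
  assumes "induced_path (parcs G) f k"
  shows "clique_number (induced G (f ` {..<k})) \<le> 2"
proof (rule clique_number_le)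
  show "finite (pverts (induced G (f ` {..<k})))" by (simp add: induced_def)
  fix K assume K: "clique (induced G (f ` {..<k})) K"
  show "card K \<le> 2"
  proof (rule card_le_2I)
    fix x y z assume xyz: "x \<in> K" "y \<in> K" "z \<in> K" "x \<noteq> y" "y \<noteq> z" "x \<noteq> z"
    then have "x \<in> f ` {..<k}" "y \<in> f ` {..<k}" "z \<in> f ` {..<k}"
      using K by (auto simp: clique_def induced_def)
    then obtain a b c where "a < k" "b < k" "c < k" "x = f a" "y = f b" "z = f c"
      by (auto elim!: imageE)
    moreover have "(x, y) \<in> parcs G" "(y, z) \<in> parcs G" "(x, z) \<in> parcs G"
      using K xyz by (auto simp: clique_def induced_def)
    ultimately have "a = Suc b \<or> b = Suc a" "b = Suc c \<or> c = Suc b" "a = Suc c \<or> c = Suc a"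
      using assms by (auto simp: induced_path_def)
    then show False by linarith
  qed
qed

lemma induced_biclique_clique_number:
  assumes "pair_graph G" "induced_biclique (parcs G) S T" "S \<subseteq> pverts G" "T \<subseteq> pverts G"
  shows "clique_number (induced G (S \<union> T)) \<le> 2"
proof (rule clique_number_le)
  show "finite (pverts (induced G (S \<union> T)))"
    using assms by (auto simp: induced_def pair_graph_iff intro: finite_subset)
  fix K assume K: "clique (induced G (S \<union> T)) K"
  show "card K \<le> 2"
  proof (rule card_le_2I)
    fix x y z assume xyz: "x \<in> K" "y \<in> K" "z \<in> K" "x \<noteq> y" "y \<noteq> z" "x \<noteq> z"
    then have "x \<in> S \<union> T" "y \<in> S \<union> T" "z \<in> S \<union> T"
      using K by (auto simp: clique_def induced_def)
    moreover have "(x, y) \<in> parcs G" "(y, z) \<in> parcs G" "(x, z) \<in> parcs G"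
      using K xyz by (auto simp: clique_def induced_def)
    ultimately show False using assms(2) unfolding induced_biclique_def indep_def by blast
  qed
qed

theorem theorem4:
  fixes \<G> :: "'a pair_pre_digraph set"
  assumes "graph_class \<G>" and "hereditary \<G>"
    and "\<exists>f :: nat \<Rightarrow> nat. \<forall>G\<in>\<G>. treedepth G \<le> f (clique_number G)"
  shows "\<exists>p :: real poly. \<forall>G\<in>\<G>. real (treedepth G) \<le> poly p (real (clique_number G))"
proof -
  obtain f :: "nat \<Rightarrow> nat" where f: "\<And>G. G \<in> \<G> \<Longrightarrow> treedepth G \<le> f (clique_number G)"
    using assms(3) by blast
  \<comment> \<open>Induced paths and bicliques have clique number at most 2, so \<open>d\<close>
    bounds the treedepth of all those in the class.\<close>
  define d where "d = Max (f ` {..2})"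
  have f_le: "f n \<le> d" if "n \<le> 2" for n unfolding d_def by (rule Max_ge) (use that in auto)
  \<comment> \<open>A path on \<open>2 ^ d\<close> vertices is already too long; the successor
    ensures \<open>k \<ge> 2\<close>, so that every vertex of the path has a neighbour on
    it.\<close>
  define k where "k = Suc (2 ^ d)"
  define s where "s = Suc d"
  define R where "R w = (w + 1) ^ s" for w :: nat
  define M where "M w = 2 * (3 * k\<^sup>2) * R w" for w
  define t where "t w = 2 * M w ^ s * R w" for w
  have bound: "treedepth G \<le> (5 * (3 * k\<^sup>2 * t w + M w + 1) + 1) ^ k"
    if G: "G \<in> \<G>" and w: "w = clique_number G" for G w
  proof -
    have pg: "pair_graph G" using assms(1) G by (simp add: graph_class_def)
    then have V: "finite (pverts G)" "parcs G \<subseteq> pverts G \<times> pverts G" "sym (parcs G)" "irrefl (parcs G)"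
      by (auto simp: pair_graph_iff)
    have small: "\<exists>anc. tree_order (Restr (parcs G) S) S anc \<and> (\<forall>v\<in>S. card (anc v) \<le> d)"
      if S: "S \<subseteq> pverts G" "clique_number (induced G S) \<le> 2" for S
    proof -
      have "induced G S \<in> \<G>" using hereditary_induced assms(1,2) G S(1) by blast
      then have "treedepth (induced G S) \<le> d" using f f_le[OF S(2)] le_trans by blast
      moreover obtain anc where "tree_order (parcs (induced G S)) (pverts (induced G S)) anc"
        "\<And>v. v \<in> pverts (induced G S) \<Longrightarrow> card (anc v) \<le> treedepth (induced G S)"
        using treedepth_tree_order[OF pair_graph_induced[OF pg S(1)]] by blast
      ultimately show ?thesis by (auto simp: induced_def intro: le_trans)
    qed
    have no_path: "\<not> induced_path (parcs G) g k" for g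
    proof
      assume g: "induced_path (parcs G) g k"
      \<comment> \<open>\<open>induced_path\<close> does not mention the vertex set, but
        \<open>g i\<close> is the end of an arc of \<open>G\<close>.\<close>
      have "g i \<in> pverts G" if "i < k" for i
      proof -
        have "\<exists>j<k. (g i, g j) \<in> parcs G"
        proof (cases "Suc i < k")
          case True
          then show ?thesis using g by (intro exI[of _ "Suc i"]) (auto simp: induced_path_def)
        next
          case False
          then have "i = Suc (i - 1)" using that by (cases i) (auto simp: k_def)
          then show ?thesis using g that by (intro exI[of _ "i - 1"]) (auto simp: induced_path_def)
        qed
        then show ?thesis using V(2) by auto
      qed
      then have sub: "g ` {..<k} \<subseteq> pverts G" by auto
      let ?xs = "map g [0..<k]"
      have set: "set ?xs = g ` {..<k}" by (auto simp: atLeast0LessThan)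
      obtain anc where anc: "tree_order (Restr (parcs G) (g ` {..<k})) (g ` {..<k}) anc"
        "\<And>v. v \<in> g ` {..<k} \<Longrightarrow> card (anc v) \<le> d"
        using small[OF sub induced_path_clique_number[OF g]] by blast
      have "length ?xs < 2 ^ d"
      proof (rule tree_order_path_bound[OF anc(1)])
        show "successively (\<lambda>x y. (x, y) \<in> Restr (parcs G) (g ` {..<k})) ?xs"
          using g by (auto simp: successively_conv_nth induced_path_def)
        show "distinct ?xs" using g by (auto simp: distinct_map induced_path_def atLeast0LessThan)
        fix y assume "y \<in> set ?xs"
        then have y: "y \<in> g ` {..<k}" using set by simp
        have "card (anc y \<inter> set ?xs) \<le> card (anc y)"
          using tree_orderD(2)[OF anc(1) y] by (intro card_mono) (auto intro: finite_subset)
        also have "\<dots> \<le> d" by (rule anc(2)[OF y])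
        finally show "card (anc y \<inter> set ?xs) \<le> d" .
      qed (use set in auto)
      then show False by (simp add: k_def)
    qed
    have no_biclique: "\<not> induced_biclique (parcs G) S T"
      if ST: "S \<subseteq> pverts G" "T \<subseteq> pverts G" and cards: "card S = s" "card T = s" for S T
    proof
      assume *: "induced_biclique (parcs G) S T"
      obtain anc where anc: "tree_order (Restr (parcs G) (S \<union> T)) (S \<union> T) anc"
        "\<And>v. v \<in> S \<union> T \<Longrightarrow> card (anc v) \<le> d"
        using small[of "S \<union> T"] induced_biclique_clique_number[OF pg * ST] ST by blast
      have "s \<le> d"
      proof (rule tree_order_biclique_bound[OF anc(1)])
        show "S \<times> T \<subseteq> Restr (parcs G) (S \<union> T)" using * by (auto simp: induced_biclique_def)
        show "finite (S \<union> T)" using ST V(1) by (auto intro: finite_subset)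
      qed (use anc(2) cards in auto)
      then show False by (simp add: s_def)
    qed
    have "\<exists>anc. tree_order (parcs G) (pverts G) anc \<and>
        (\<forall>v\<in>pverts G. card (anc v) \<le> (5 * (3 * k\<^sup>2 * t w + M w + 1) + 1) ^ k)"
      unfolding t_def M_def R_def
    proof (rule tree_order_of_path_biclique_free[OF V no_path])
      show "card K \<le> w" if "K \<subseteq> pverts G" "clique_set (parcs G) K" for K
        using card_le_clique_number[OF V(1), of K] that w by (simp add: clique_iff)
    qed (use no_biclique in blast)
    then show ?thesis using treedepth_le[OF pg] by blast
  qed
  \<comment> \<open>\<open>Rp\<close>, \<open>Mp\<close> and \<open>tp\<close> copy
    \<open>R\<close>, \<open>M\<close> and \<open>t\<close> with \<open>w\<close> as the variable;
    \<open>s\<close> and \<open>k\<close> are constants.\<close>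
  define Rp :: "real poly" where "Rp = [:1, 1:] ^ s"
  define Mp where "Mp = smult (real (2 * (3 * k\<^sup>2))) Rp"
  define tp where "tp = smult 2 (Mp ^ s * Rp)"
  define p where "p = (smult 5 (smult (real (3 * k\<^sup>2)) tp + Mp + 1) + 1) ^ k"
  have "poly Rp (real w) = real (R w)" for w by (simp add: Rp_def R_def add.commute)
  then have "poly Mp (real w) = real (M w)" and "poly tp (real w) = real (t w)" for w
    by (simp_all add: Mp_def M_def tp_def t_def)
  then have "poly p (real w) = real ((5 * (3 * k\<^sup>2 * t w + M w + 1) + 1) ^ k)" for w
    by (simp add: p_def)
  then show ?thesis using bound by (intro exI[of _ p]) (metis of_nat_le_iff)
qed

end
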